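(* Let $\xi$ and $\eta$ be invariant (hence jointly stationary and ergodic) random measures on $\mathbb{R}$ with finite intensities $\lambda_\xi=\mathbb{E}\,\xi[0,1]$ and $\lambda_\eta=\mathbb{E}\,\eta[0,1]$. Assume that $\xi$ and $\eta$ are mutually singular ($\mathbb{P}$-a.e.), that $\xi$ is diffuse ($\mathbb{P}$-a.e.), and that $\lambda_\xi=\lambda_\eta$. Then the allocation $\tau$ defined by $$\tau(s):=\inf\{t> s : \xi[s,t]\le \eta[s,t]\},\quad s\in\mathbb{R},$$ (with $\inf\emptyset:=\infty$) balances $\xi$ and $\eta$.
   Context: $(\Omega,\mathcal{F},\mathbb{P})$ is a $\sigma$-finite measure space with integral operator $\mathbb{E}$, equipped with a measurable flow $(\theta_s)_{s\in\mathbb{R}}$: mappings $\theta_s:\Omega\to\Omega$ such that $(\omega,s)\mapsto\theta_s\omega$ is measurable, $\theta_0$ is the identity and $\theta_s\circ\theta_t=\theta_{s+t}$. The measure $\mathbb{P}$ is stationary ($\mathbb{P}(\theta_sA)=\mathbb{P}(A)$ for all $s\in\mathbb{R}$, $A\in\mathcal{F}$) and ergodic (if $A\in\mathcal{F}$ satisfies $\theta_sA=A$ for all $s$, then $\mathbb{P}(A)=0$ or $\mathbb{P}(A^c)=0$). A random measure $\xi$ on $\mathbb{R}$ is a kernel from $\Omega$ to $\mathbb{R}$ such that, for $\mathbb{P}$-a.e. $\omega$, $\xi(\omega,C)<\infty$ for all compact $C\subset\mathbb{R}$. It is invariant if for $\mathbb{P}$-a.e. $\omega$: $\xi(\theta_t\omega,C-t)=\xi(\omega,C)$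 for all Borel $C\subset\mathbb{R}$ and $t\in\mathbb{R}$. It is diffuse if $\xi\{t\}=0$ for all $t\in\mathbb{R}$. An allocation is a measurable mapping $\tau:\Omega\times\mathbb{R}\to\mathbb{R}\cup\{\infty\}$ such that $\tau(\theta_t\omega,s-t)=\tau(\omega,s)-t$ for all $s,t\in\mathbb{R}$ and $\mathbb{P}$-a.e. $\omega$. As usual $\tau(s)=\tau(\omega,s)$. The allocation $\tau$ balances $\xi$ and $\eta$ if $\mathbb{P}(\xi(\{s\in\mathbb{R}:\tau(s)=\infty\})>0)=0$ and, $\mathbb{P}$-a.e., $\int \mathbf{1}\{\tau(s)\in C\}\,\xi(ds)=\eta(C)$ for all Borel $C\subset\mathbb{R}$.
   Formalization: If P is infinite, ξ is also assumed to have total mass 0 or ∞ a.e. (for σ-finite P the claim can fail otherwise); and τ is shown to be an allocation only after modification at those ω where ξ or η is not locally finite or ξ is not diffuse. *)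

theory Defs
  imports "HOL-Analysis.Analysis"
begin

text \<open>The flow is only constrained on the underlying space \<open>space M\<close>; since \<open>\<theta> s\<close> is
  bijective there with inverse \<open>\<theta> (- s)\<close>, the image \<open>\<theta> s ` A\<close> of a measurable set is measurable.\<close>

locale stationary_ergodic_flow = sigma_finite_measure M for M :: "'w measure" +
  fixes \<theta> :: "real \<Rightarrow> 'w \<Rightarrow> 'w"
  assumes flow_measurable: "(\<lambda>(\<omega>, s). \<theta> s \<omega>) \<in> M \<Otimes>\<^sub>M borel \<rightarrow>\<^sub>M M"
    and flow_zero: "\<And>\<omega>. \<omega> \<in> space M \<Longrightarrow> \<theta> 0 \<omega> = \<omega>"
    and flow_add: "\<And>s t \<omega>. \<omega> \<in> space M \<Longrightarrow> \<theta> s (\<theta> t \<omega>) = \<theta> (s + t) \<omega>"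
    and stationary: "\<And>s A. A \<in> sets M \<Longrightarrow> emeasure M (\<theta> s ` A) = emeasure M A"
    and ergodic: "\<And>A. A \<in> sets M \<Longrightarrow> (\<And>s. \<theta> s ` A = A) \<Longrightarrow>
      emeasure M A = 0 \<or> emeasure M (space M - A) = 0"

definition locally_finite :: "real measure \<Rightarrow> bool" where
  "locally_finite \<mu> \<longleftrightarrow> (\<forall>C. compact C \<longrightarrow> emeasure \<mu> C < \<infinity>)"

definition diffuse :: "real measure \<Rightarrow> bool" where
  "diffuse \<mu> \<longleftrightarrow> (\<forall>t. emeasure \<mu> {t} = 0)"

definition mutually_singular :: "real measure \<Rightarrow> real measure \<Rightarrow> bool" where
  "mutually_singular \<mu> \<nu> \<longleftrightarrow> (\<exists>A\<in>sets borel. emeasure \<mu> A = 0 \<and> emeasure \<nu> (- A) = 0)"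

definition random_measure :: "'w measure \<Rightarrow> ('w \<Rightarrow> real measure) \<Rightarrow> bool" where
  "random_measure M \<xi> \<longleftrightarrow>
     (\<forall>\<omega>\<in>space M. sets (\<xi> \<omega>) = sets borel) \<and>
     (\<forall>C\<in>sets borel. (\<lambda>\<omega>. emeasure (\<xi> \<omega>) C) \<in> borel_measurable M) \<and>
     (AE \<omega> in M. locally_finite (\<xi> \<omega>))"

definition invariant_random_measure ::
  "'w measure \<Rightarrow> (real \<Rightarrow> 'w \<Rightarrow> 'w) \<Rightarrow> ('w \<Rightarrow> real measure) \<Rightarrow> bool" where
  "invariant_random_measure M \<theta> \<xi> \<longleftrightarrow> random_measure M \<xi> \<and>
     (AE \<omega> in M. \<forall>C\<in>sets borel. \<forall>t. emeasure (\<xi> (\<theta> t \<omega>)) ((\<lambda>x. x - t) ` C) = emeasure (\<xi> \<omega>) C)"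

definition intensity :: "'w measure \<Rightarrow> ('w \<Rightarrow> real measure) \<Rightarrow> ennreal" where
  "intensity M \<xi> = (\<integral>\<^sup>+\<omega>. emeasure (\<xi> \<omega>) {0..1} \<partial>M)"

text \<open>Values in \<open>\<real> \<union> {\<infinity>}\<close> are extended reals different from \<open>-\<infinity>\<close>.\<close>

definition allocation ::
  "'w measure \<Rightarrow> (real \<Rightarrow> 'w \<Rightarrow> 'w) \<Rightarrow> ('w \<Rightarrow> real \<Rightarrow> ereal) \<Rightarrow> bool" where
  "allocation M \<theta> \<tau> \<longleftrightarrow>
     (\<lambda>(\<omega>, s). \<tau> \<omega> s) \<in> borel_measurable (M \<Otimes>\<^sub>M borel) \<and>
     (\<forall>\<omega>\<in>space M. \<forall>s. \<tau> \<omega> s \<noteq> -\<infinity>) \<and>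
     (AE \<omega> in M. \<forall>s t. \<tau> (\<theta> t \<omega>) (s - t) = \<tau> \<omega> s - ereal t)"

text \<open>The first clause uses the almost-everywhere quantifier of \<open>\<xi> \<omega>\<close> rather than
  \<open>emeasure\<close>, because \<open>emeasure\<close> vanishes on every non-measurable set.\<close>

definition balances ::
  "'w measure \<Rightarrow> ('w \<Rightarrow> real measure) \<Rightarrow> ('w \<Rightarrow> real measure) \<Rightarrow> ('w \<Rightarrow> real \<Rightarrow> ereal) \<Rightarrow> bool" where
  "balances M \<xi> \<eta> \<tau> \<longleftrightarrow>
     (AE \<omega> in M. AE s in \<xi> \<omega>. \<tau> \<omega> s \<noteq> \<infinity>) \<and>
     (AE \<omega> in M. \<forall>C\<in>sets borel.
        (\<integral>\<^sup>+s. indicator (ereal ` C) (\<tau> \<omega> s) \<partial>\<xi> \<omega>) = emeasure (\<eta> \<omega>) C)"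

text \<open>The infimum is taken in the extended reals, so it is \<open>\<infinity>\<close> for the empty set.\<close>

definition first_match ::
  "('w \<Rightarrow> real measure) \<Rightarrow> ('w \<Rightarrow> real measure) \<Rightarrow> 'w \<Rightarrow> real \<Rightarrow> ereal" where
  "first_match \<xi> \<eta> \<omega> s =
     Inf (ereal ` {t. s < t \<and> emeasure (\<xi> \<omega>) {s..t} \<le> emeasure (\<eta> \<omega>) {s..t}})"

text \<open>A stationary random measure on a finite measure space has total mass \<open>0\<close> or \<open>\<infinity>\<close> almost
  everywhere. On an infinite measure space this may fail, even for an ergodic flow: let
  \<open>\<theta> t \<omega> = \<omega> - t\<close> act on Lebesgue measure and take for \<open>\<xi> \<omega>\<close> the uniform distribution
  on \<open>{\<omega>..\<omega> + 1}\<close> and for \<open>\<eta> \<omega>\<close> the point mass at \<open>\<omega> - 1\<close>. These are invariant, mutually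
  singular and of intensity \<open>1\<close>, but all mass of \<open>\<eta> \<omega>\<close> lies to the left of that of \<open>\<xi> \<omega>\<close>, so
  that \<open>first_match \<xi> \<eta> \<omega> s = \<infinity>\<close> for \<open>\<xi> \<omega>\<close>-almost every \<open>s\<close>. The following
  condition, void for finite \<open>M\<close>, excludes this.\<close>

definition zero_or_infinite_mass :: "'w measure \<Rightarrow> ('w \<Rightarrow> real measure) \<Rightarrow> bool" where
  "zero_or_infinite_mass M \<xi> \<longleftrightarrow>
     (AE \<omega> in M. emeasure (\<xi> \<omega>) UNIV = 0 \<or> emeasure (\<xi> \<omega>) UNIV = \<infinity>)"

text \<open>A random measure is arbitrary on a null set, where \<open>first_match\<close> need not be measurable.
  Being an allocation is therefore claimed after changing it only at those \<open>\<omega>\<close> at which one of the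
  almost-everywhere regularity properties below fails.\<close>

definition regular_at :: "('w \<Rightarrow> real measure) \<Rightarrow> ('w \<Rightarrow> real measure) \<Rightarrow> 'w \<Rightarrow> bool" where
  "regular_at \<xi> \<eta> \<omega> \<longleftrightarrow>
     locally_finite (\<xi> \<omega>) \<and> locally_finite (\<eta> \<omega>) \<and> diffuse (\<xi> \<omega>)"

end

theory Submission
  imports Defs "HOL-Probability.Distribution_Functions"
begin

text \<open>The proof separates what happens for one realisation from what stationarity adds.

  For one realisation, let \<open>\<mu>\<close> be diffuse and \<open>\<nu>\<close> singular to it, both locally finite, and let \<open>f\<close>
  be a primitive of \<open>\<nu> - \<mu>\<close>. The matching time \<open>\<tau> s\<close> is the first time after \<open>s\<close> at which \<open>f\<close> returns
  to its level \<open>f (s-)\<close>. Hence, up to the single point \<open>b\<close>, the points of \<open>{c<..b}\<close> with \<open>\<tau> s > b\<close>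
  are the strict ladder points of \<open>f\<close> seen from \<open>b\<close> to the left. At these points the running maximum
  increases, as one moves to the left, at the expense of \<open>\<mu>\<close> alone: a part paid by \<open>\<mu>\<close> and \<open>\<nu>\<close>
  jointly is excluded by singularity. So the ladder points have \<open>\<mu>\<close>-mass \<open>max {f t | c \<le> t \<le> b} - f b\<close>
  (\<open>measure_records\<close>). Subtracting this identity for \<open>b\<close> from the one for \<open>a\<close> gives
    \<open>\<mu> {s. c < s \<le> b, a < \<tau> s \<le> b} = \<nu> {a<..b} - (max {f t | c \<le> t \<le> b} - max {f t | c \<le> t \<le> a})\<close>
  (\<open>window_mass\<close>). Letting \<open>c\<close> tend to \<open>-\<infinity>\<close>, the image of \<open>\<mu>\<close> under \<open>\<tau>\<close> never exceeds \<open>\<nu>\<close>. If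
  \<open>\<tau> c = \<infinity>\<close> then \<open>f\<close> stays below its level at \<open>c\<close>, both maxima are \<open>f c\<close>, and to the right of \<open>c\<close> the
  image is exactly \<open>\<nu>\<close>.

  Now let \<open>\<mu> = \<xi> \<omega>\<close> and \<open>\<nu> = \<eta> \<omega>\<close>. Cutting time into unit cells and using stationarity, the mean
  mass of \<open>\<xi>\<close> that is sent to \<open>{0<..1}\<close> equals the mean mass of \<open>\<xi>\<close> on \<open>{0<..1}\<close> that is sent
  somewhere (\<open>mass_transport\<close>). The unmatched mass, that is, \<open>\<xi>\<close> restricted to \<open>{s. \<tau> s = \<infinity>}\<close>, cannot
  have a leftmost end: the unit cell containing this end would be a wandering event, along whose
  orbits \<open>\<xi>\<close> has finite total mass (and constants are summable if the underlying measure is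
  finite), which the hypothesis on the mass forbids (\<open>first_unmatched_null\<close>). By ergodicity there
  remain two cases. If almost surely nothing is unmatched, mass transport and the equality of the
  intensities show that the image of \<open>\<xi>\<close>, which is at most \<open>\<eta>\<close>, has the same intensity as \<open>\<eta>\<close>, so
  they agree. If almost surely there are unmatched points arbitrarily far to the left, then the image
  is exactly \<open>\<eta>\<close>, and mass transport read backwards shows that no mass is unmatched after all.

  The invariance of \<open>\<xi>\<close> and \<open>\<eta>\<close> holds only almost everywhere. It propagates along whole orbits,
  so that it can be assumed everywhere after replacing both measures by \<open>0\<close> off an invariant event
  of full measure (\<open>invariant_conull_core\<close>).\<close>

section \<open>Comparing measures through half-open intervals\<close>

text \<open>An open set is the increasing union, over \<open>n\<close>, of the disjoint dyadic intervals of length \<open>2^-n\<close>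
  that it contains.\<close>

lemma open_Ioc_domination:
  fixes \<alpha> \<beta> \<gamma> :: "real measure"
  assumes sets: "sets \<alpha> = sets borel" "sets \<beta> = sets borel" "sets \<gamma> = sets borel"
    and le: "\<And>x y. x < y \<Longrightarrow> emeasure \<alpha> {x<..y} \<le> emeasure \<beta> {x<..y} + emeasure \<gamma> {x<..y}"
    and "open U"
  shows "emeasure \<alpha> U \<le> emeasure \<beta> U + emeasure \<gamma> U"
proof -
  define I where "I n k = {real_of_int k / 2^n <.. (real_of_int k + 1) / 2^n}" for n :: nat and k
  define K where "K n = {k. I n k \<subseteq> U}" for n
  define V where "V n = (\<Union>k\<in>K n. I n k)" for n
  \<comment> \<open>A point lies in exactly one dyadic interval of each order; its index is given by the ceiling
    because the intervals are closed on the right.\<close>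
  have I_iff: "x \<in> I n k \<longleftrightarrow> k = \<lceil>x * 2^n\<rceil> - 1" for x n k
  proof -
    have "x \<in> I n k \<longleftrightarrow> real_of_int k < x * 2^n \<and> x * 2^n \<le> real_of_int k + 1"
      unfolding I_def by (simp add: divide_less_eq le_divide_eq)
    also have "\<dots> \<longleftrightarrow> \<lceil>x * 2^n\<rceil> = k + 1"
      by (simp add: ceiling_eq_iff)
    also have "\<dots> \<longleftrightarrow> k = \<lceil>x * 2^n\<rceil> - 1" by auto
    finally show ?thesis .
  qed
  have V_iff: "x \<in> V n \<longleftrightarrow> I n (\<lceil>x * 2^n\<rceil> - 1) \<subseteq> U" for x n
    unfolding V_def K_def by (auto simp: I_iff)
  have I_meas: "I n k \<in> sets borel" for n k unfolding I_def by simp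
  have disj: "disjoint_family_on (I n) (K n)" for n
    unfolding disjoint_family_on_def by (auto simp: I_iff)
  have sum: "emeasure \<mu> (V n) = (\<integral>\<^sup>+k. emeasure \<mu> (I n k) \<partial>count_space (K n))"
    if "sets \<mu> = sets borel" for n and \<mu> :: "real measure"
    unfolding V_def by (rule emeasure_UN_countable) (auto simp: that I_meas disj)
  have V_le: "emeasure \<alpha> (V n) \<le> emeasure \<beta> (V n) + emeasure \<gamma> (V n)" for n
    unfolding sum[OF sets(1)] sum[OF sets(2)] sum[OF sets(3)]
    by (subst nn_integral_add[symmetric])
      (auto intro!: nn_integral_mono le simp: I_def divide_strict_right_mono)
  have V_sub: "V n \<subseteq> U" for n by (auto simp: V_def K_def)
  \<comment> \<open>Refining the partition can only enlarge the union of the intervals inside \<open>U\<close>.\<close>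
  have nest: "I (Suc n) (\<lceil>x * 2^Suc n\<rceil> - 1) \<subseteq> I n (\<lceil>x * 2^n\<rceil> - 1)" for n and x :: real
  proof
    fix y assume "y \<in> I (Suc n) (\<lceil>x * 2^Suc n\<rceil> - 1)"
    then have "\<lceil>x * 2^Suc n\<rceil> = \<lceil>y * 2^Suc n\<rceil>"
      by (simp add: I_iff del: power_Suc)
    moreover have "u * 2^Suc n = 2 * (u * 2^n)" for u :: real
      by simp
    ultimately have "\<lceil>2 * (x * 2^n)\<rceil> = \<lceil>2 * (y * 2^n)\<rceil>"
      by (simp only:)
    moreover have "\<lceil>2 * u\<rceil> = 2 * \<lceil>u\<rceil> \<or> \<lceil>2 * u\<rceil> = 2 * \<lceil>u\<rceil> - 1" for u :: real
      by linarith
    ultimately have "\<lceil>x * 2^n\<rceil> = \<lceil>y * 2^n\<rceil>"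
      by smt
    then show "y \<in> I n (\<lceil>x * 2^n\<rceil> - 1)" by (simp add: I_iff)
  qed
  have inc: "incseq V"
  proof (rule incseq_SucI, rule subsetI)
    fix n x assume "x \<in> V n"
    then have "I n (\<lceil>x * 2^n\<rceil> - 1) \<subseteq> U" by (simp only: V_iff)
    with nest[of n x] have "I (Suc n) (\<lceil>x * 2^Suc n\<rceil> - 1) \<subseteq> U" by (rule subset_trans)
    then show "x \<in> V (Suc n)" by (simp only: V_iff)
  qed
  have "U \<subseteq> (\<Union>n. V n)"
  proof
    fix x assume "x \<in> U"
    then obtain e where e: "e > 0" "ball x e \<subseteq> U"
      using \<open>open U\<close> openE by blast
    obtain n where n: "1 / e < 2 ^ n"
      using real_arch_pow[of 2 "1/e"] by auto
    have small: "1 / 2^n < e"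
      using n e(1) by (simp add: field_simps)
    have "I n (\<lceil>x * 2^n\<rceil> - 1) \<subseteq> ball x e"
    proof
      fix y assume y: "y \<in> I n (\<lceil>x * 2^n\<rceil> - 1)"
      have x: "x \<in> I n (\<lceil>x * 2^n\<rceil> - 1)" by (simp add: I_iff)
      have "\<bar>x - y\<bar> < 1 / 2^n"
        using x y unfolding I_def by (simp add: add_divide_distrib diff_divide_distrib abs_less_iff)
      then show "y \<in> ball x e" using small by (simp add: dist_real_def)
    qed
    then show "x \<in> (\<Union>n. V n)" using e(2) V_iff by auto
  qed
  then have U: "U = (\<Union>n. V n)" using V_sub by auto
  have V_meas: "V n \<in> sets borel" for n
    unfolding V_def by (intro sets.countable_UN') (auto simp: I_meas)
  have "emeasure \<alpha> U = (SUP n. emeasure \<alpha> (V n))"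
    unfolding U by (rule SUP_emeasure_incseq[symmetric]) (auto simp: sets V_meas inc)
  also have "\<dots> \<le> emeasure \<beta> U + emeasure \<gamma> U"
  proof (rule SUP_least)
    fix n
    have "emeasure \<beta> (V n) + emeasure \<gamma> (V n) \<le> emeasure \<beta> U + emeasure \<gamma> U"
      by (intro add_mono emeasure_mono V_sub) (auto simp: sets \<open>open U\<close>)
    then show "emeasure \<alpha> (V n) \<le> emeasure \<beta> U + emeasure \<gamma> U"
      using V_le[of n] by (rule order_trans[rotated])
  qed
  finally show ?thesis .
qed

lemma (in finite_borel_measure) outer_open_approximation:
  assumes "E \<in> sets borel" and "0 < e"
  shows "\<exists>U. E \<subseteq> U \<and> open U \<and> emeasure M U \<le> emeasure M E + ennreal e"
proof -
  have eq: "emeasure M E = (INF U \<in> {U. E \<subseteq> U \<and> open U}. emeasure M U)"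
    by (rule outer_regular[OF M_is_borel emeasure_finite[unfolded infinity_ennreal_def[symmetric]] assms(1)])
  have "ennreal (measure M E) < ennreal (measure M E + e)"
    using \<open>0 < e\<close> measure_nonneg[of M E] by (subst ennreal_less_iff) auto
  then have "emeasure M E < emeasure M E + ennreal e"
    using \<open>0 < e\<close> unfolding emeasure_eq_measure by (subst ennreal_plus[symmetric]) auto
  then have "(INF U \<in> {U. E \<subseteq> U \<and> open U}. emeasure M U) < emeasure M E + ennreal e"
    by (simp only: eq[symmetric])
  then have "\<exists>U\<in>{U. E \<subseteq> U \<and> open U}. emeasure M U < emeasure M E + ennreal e"
    by (simp only: INF_less_iff)
  then obtain U where "E \<subseteq> U" "open U" "emeasure M U < emeasure M E + ennreal e"
    by auto
  then show ?thesis
    by (meson less_imp_le)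
qed

text \<open>The sum \<open>\<beta> + \<gamma>\<close> is kept as two measures, so that each can be approximated from outside by
  open sets on its own.\<close>

lemma borel_Ioc_domination:
  fixes \<alpha> \<beta> \<gamma> :: "real measure"
  assumes \<alpha>: "sets \<alpha> = sets borel"
    and \<beta>: "finite_borel_measure \<beta>" and \<gamma>: "finite_borel_measure \<gamma>"
    and le: "\<And>x y. x < y \<Longrightarrow> emeasure \<alpha> {x<..y} \<le> emeasure \<beta> {x<..y} + emeasure \<gamma> {x<..y}"
    and E: "E \<in> sets borel"
  shows "emeasure \<alpha> E \<le> emeasure \<beta> E + emeasure \<gamma> E"
proof (rule ennreal_le_epsilon)
  interpret \<beta>: finite_borel_measure \<beta> by fact
  interpret \<gamma>: finite_borel_measure \<gamma> by fact
  fix e :: real assume "0 < e"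
  obtain U W where U: "E \<subseteq> U" "open U" "emeasure \<beta> U \<le> emeasure \<beta> E + ennreal (e/2)"
    and W: "E \<subseteq> W" "open W" "emeasure \<gamma> W \<le> emeasure \<gamma> E + ennreal (e/2)"
    using \<beta>.outer_open_approximation[OF E] \<gamma>.outer_open_approximation[OF E] half_gt_zero[OF \<open>0 < e\<close>]
    by meson
  have UW: "open (U \<inter> W)" "E \<subseteq> U \<inter> W" using U(1,2) W(1,2) by auto
  have "emeasure \<alpha> E \<le> emeasure \<alpha> (U \<inter> W)"
    using UW by (intro emeasure_mono) (simp_all add: \<alpha>)
  also have "\<dots> \<le> emeasure \<beta> (U \<inter> W) + emeasure \<gamma> (U \<inter> W)"
    by (rule open_Ioc_domination[OF \<alpha> \<beta>.M_is_borel \<gamma>.M_is_borel le UW(1)])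
  also have "\<dots> \<le> emeasure \<beta> U + emeasure \<gamma> W"
    using U(2) W(2) by (intro add_mono emeasure_mono) (simp_all add: \<beta>.M_is_borel \<gamma>.M_is_borel)
  also have "\<dots> \<le> (emeasure \<beta> E + ennreal (e/2)) + (emeasure \<gamma> E + ennreal (e/2))"
    by (intro add_mono U(3) W(3))
  also have "\<dots> = emeasure \<beta> E + emeasure \<gamma> E + (ennreal (e/2) + ennreal (e/2))"
    by (simp add: ac_simps)
  also have "ennreal (e/2) + ennreal (e/2) = ennreal e"
    using \<open>0 < e\<close> by (subst ennreal_plus[symmetric]) auto
  finally show "emeasure \<alpha> E \<le> emeasure \<beta> E + emeasure \<gamma> E + ennreal e" .
qed

section \<open>Ladder points of the difference of two distribution functions\<close>

locale finite_singular_pair = \<mu>: finite_borel_measure \<mu> + \<nu>: finite_borel_measure \<nu>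
  for \<mu> \<nu> :: "real measure" +
  assumes atomless: "diffuse \<mu>"
    and singular: "mutually_singular \<mu> \<nu>"
begin

text \<open>The process \<open>walk\<close> is right-continuous and, since \<open>\<mu>\<close> has no atoms, has only upward jumps. With
  \<open>walk t - walk (s-) = \<nu> {s..t} - \<mu> {s..t}\<close>, the set \<open>records a b\<close> consists of the points \<open>s\<close> at
  which \<open>walk\<close>, read from \<open>b\<close> to the left, reaches a new strict maximum. The right end point \<open>b\<close>
  always belongs to it.\<close>

definition walk :: "real \<Rightarrow> real" where
  "walk t = cdf \<nu> t - cdf \<mu> t"

definition run_max :: "real \<Rightarrow> real \<Rightarrow> real" where
  "run_max b s = (SUP t\<in>{s..b}. walk t)"

definition records :: "real \<Rightarrow> real \<Rightarrow> real set" where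
  "records a b = {s\<in>{a<..b}. \<forall>t\<in>{s<..b}. emeasure \<nu> {s..t} < emeasure \<mu> {s..t}}"

lemma measure_singleton: "measure \<mu> {t} = 0"
  using atomless by (simp add: diffuse_def measure_def)

lemma isCont_cdf: "isCont (cdf \<mu>) t"
  by (simp add: \<mu>.isCont_cdf measure_singleton)

lemma measure_Icc: "s \<le> t \<Longrightarrow> measure \<mu> {s..t} = cdf \<mu> t - cdf \<mu> s"
proof -
  assume "s \<le> t"
  then have "{s..t} = {s} \<union> {s<..t}" by auto
  then have "measure \<mu> {s..t} = measure \<mu> {s} + measure \<mu> {s<..t}"
    by (simp only:) (rule \<mu>.finite_measure_Union, auto)
  moreover have "measure \<mu> {s<..t} = cdf \<mu> t - cdf \<mu> s"
    using \<open>s \<le> t\<close> \<mu>.cdf_diff_eq[of s t] by (cases "s = t") auto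
  ultimately show ?thesis by (simp add: measure_singleton)
qed

lemma measure_Icc_eq: "s \<le> t \<Longrightarrow> measure \<nu> {s..t} = cdf \<nu> t - measure \<nu> {..<s}"
proof -
  assume "s \<le> t"
  then have "{..t} = {..<s} \<union> {s..t}" by auto
  then have "measure \<nu> {..t} = measure \<nu> {..<s} + measure \<nu> {s..t}"
    by (simp only:) (rule \<nu>.finite_measure_Union, auto)
  then show ?thesis by (simp add: cdf_def)
qed

lemma walk_le: "walk t \<le> measure \<nu> (space \<nu>)"
  using \<nu>.cdf_bounded[of t] \<mu>.cdf_nonneg[of t] by (simp add: walk_def)

lemma bdd_above_walk: "bdd_above (walk ` A)"
  by (rule bdd_aboveI2, rule walk_le)

lemma walk_le_run_max: "s \<le> t \<Longrightarrow> t \<le> b \<Longrightarrow> walk t \<le> run_max b s"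
  unfolding run_max_def by (intro cSUP_upper bdd_above_walk) auto

lemma run_max_least: "s \<le> b \<Longrightarrow> (\<And>t. s \<le> t \<Longrightarrow> t \<le> b \<Longrightarrow> walk t \<le> c) \<Longrightarrow> run_max b s \<le> c"
  unfolding run_max_def by (intro cSUP_least) auto

lemma run_max_self: "run_max b b = walk b"
  by (intro antisym run_max_least walk_le_run_max) auto

lemma run_max_antimono: "x \<le> y \<Longrightarrow> y \<le> b \<Longrightarrow> run_max b y \<le> run_max b x"
  by (intro run_max_least walk_le_run_max) auto

lemma run_max_mono: "s \<le> a \<Longrightarrow> a \<le> b \<Longrightarrow> run_max a s \<le> run_max b s"
  by (intro run_max_least walk_le_run_max) auto

text \<open>As \<open>walk\<close> can decrease only through \<open>\<mu>\<close>, the running maximum is absolutely continuous with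
  respect to \<open>\<mu>\<close>.\<close>

lemma run_max_increment:
  assumes "x \<le> y" "y \<le> b"
  shows "run_max b x \<le> run_max b y + (cdf \<mu> y - cdf \<mu> x)"
proof (rule run_max_least)
  fix t assume t: "x \<le> t" "t \<le> b"
  show "walk t \<le> run_max b y + (cdf \<mu> y - cdf \<mu> x)"
  proof (cases "t \<le> y")
    case True
    have "walk t \<le> walk y + (cdf \<mu> y - cdf \<mu> x)"
      using \<mu>.cdf_nondecreasing[OF t(1)] \<nu>.cdf_nondecreasing[OF True] by (simp add: walk_def)
    also have "walk y \<le> run_max b y" using assms by (intro walk_le_run_max) auto
    finally show ?thesis by simp
  next
    case False
    then have "walk t \<le> run_max b y" using t by (intro walk_le_run_max) auto
    then show ?thesis using \<mu>.cdf_nondecreasing[OF assms(1)] by simp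
  qed
qed (use assms in auto)

lemma walk_le_at_record:
  assumes "s \<in> records a b" "s \<le> t" "t \<le> b"
  shows "walk t \<le> walk s"
proof (cases "t = s")
  case False
  then have "s < t" using assms by auto
  have "emeasure \<nu> {s..t} < emeasure \<mu> {s..t}"
    using assms \<open>s < t\<close> by (auto simp: records_def)
  then have "measure \<nu> {s..t} < measure \<mu> {s..t}"
    by (simp add: \<nu>.emeasure_eq_measure \<mu>.emeasure_eq_measure ennreal_less_iff)
  moreover have "measure \<nu> {s<..t} \<le> measure \<nu> {s..t}"
    by (rule \<nu>.finite_measure_mono) auto
  ultimately show ?thesis
    using \<nu>.cdf_diff_eq[OF \<open>s < t\<close>] measure_Icc[of s t] \<open>s < t\<close> by (simp add: walk_def)
qed simp

lemma run_max_record: "s \<in> records a b \<Longrightarrow> run_max b s = walk s"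
  using walk_le_at_record[of s a b]
  by (intro antisym run_max_least walk_le_run_max) (auto simp: records_def)

text \<open>Off the ladder points, the running maximum is constant on one side of the point: on the left if
  the maximum exceeds the left limit \<open>g\<close> of \<open>walk\<close>, and on the right if it is attained again later.
  The interval of constancy contains a rational number, so countably many levels account for all
  points that are not ladder points.\<close>

lemma run_max_nonrecord:
  assumes s: "a < s" "s \<le> b" "s \<notin> records a b"
  shows "\<exists>q\<in>\<rat>. a < q \<and> q < b \<and> run_max b q = run_max b s"
proof -
  define g where "g = measure \<nu> {..<s} - cdf \<mu> s"
  obtain t where t: "s < t" "t \<le> b" and ge: "emeasure \<mu> {s..t} \<le> emeasure \<nu> {s..t}"
    using s by (auto simp: records_def not_less)
  have "measure \<mu> {s..t} \<le> measure \<nu> {s..t}"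
    using ge by (simp add: \<nu>.emeasure_eq_measure \<mu>.emeasure_eq_measure)
  then have g: "g \<le> walk t"
    using t by (simp add: measure_Icc measure_Icc_eq g_def walk_def)
  show ?thesis
  proof (cases "g < run_max b s")
    case True
    have "(walk \<longlongrightarrow> g) (at_left s)"
      unfolding walk_def g_def
      by (intro tendsto_diff \<nu>.cdf_at_left isCont_cdf[of s, unfolded isCont_def, THEN tendsto_mono[rotated]])
        (auto simp: at_within_le_at)
    then have "eventually (\<lambda>u. walk u < run_max b s) (at_left s)"
      using True by (rule order_tendstoD)
    then obtain d where d: "d < s" "\<And>u. d < u \<Longrightarrow> u < s \<Longrightarrow> walk u < run_max b s"
      by (auto simp: eventually_at_left[of "s - 1" s])
    obtain q where q: "q \<in> \<rat>" "max a d < q" "q < s"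
      using Rats_dense_in_real[of "max a d" s] s d(1) by auto
    have "run_max b q \<le> run_max b s"
    proof (rule run_max_least)
      fix u assume "q \<le> u" "u \<le> b"
      then show "walk u \<le> run_max b s"
        using d(2)[of u] q by (cases "u < s") (auto intro!: walk_le_run_max)
    qed (use q s in auto)
    then have "run_max b q = run_max b s"
      using run_max_antimono[of q s b] q s by auto
    then show ?thesis using q s t by (intro bexI[of _ q]) auto
  next
    case False
    obtain q where q: "q \<in> \<rat>" "s < q" "q < t"
      using Rats_dense_in_real[of s t] t by auto
    have "run_max b s \<le> walk t" using False g by simp
    also have "walk t \<le> run_max b q" using q t by (intro walk_le_run_max) auto
    finally have "run_max b q = run_max b s"
      using run_max_antimono[of s q b] q t by auto
    then show ?thesis using q s t by (intro bexI[of _ q]) auto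
  qed
qed

text \<open>The decrease of the running maximum from \<open>a\<close> to \<open>x\<close>, extended constantly outside \<open>{a..b}\<close>. It
  is the distribution function of the measure \<open>descent_measure\<close> below, which on the ladder points
  will turn out to be \<open>\<mu>\<close>.\<close>

definition descent :: "real \<Rightarrow> real \<Rightarrow> real \<Rightarrow> real" where
  "descent a b x = run_max b a - run_max b (max a (min x b))"

context
  fixes a b :: real
  assumes "a < b"
begin

lemma descent_mono: "x \<le> y \<Longrightarrow> descent a b x \<le> descent a b y"
  unfolding descent_def using \<open>a < b\<close> by (intro diff_left_mono run_max_antimono) auto

lemma descent_increment: "x \<le> y \<Longrightarrow> descent a b y \<le> descent a b x + (cdf \<mu> y - cdf \<mu> x)"
proof -
  assume "x \<le> y"
  let ?x = "max a (min x b)" and ?y = "max a (min y b)"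
  have "?x \<le> ?y" "?y \<le> b" using \<open>x \<le> y\<close> \<open>a < b\<close> by auto
  moreover have "cdf \<mu> ?y - cdf \<mu> ?x \<le> cdf \<mu> y - cdf \<mu> x"
  proof (cases "?x = ?y")
    case True
    then show ?thesis using \<mu>.cdf_nondecreasing[OF \<open>x \<le> y\<close>] by simp
  next
    case False
    then have "x \<le> ?x" "?y \<le> y" using \<open>x \<le> y\<close> \<open>a < b\<close> by (simp_all add: max_def min_def split: if_splits)
    then show ?thesis using \<mu>.cdf_nondecreasing[of x ?x] \<mu>.cdf_nondecreasing[of ?y y] by simp
  qed
  ultimately show ?thesis using run_max_increment[of ?x ?y b] by (simp add: descent_def)
qed

lemma isCont_descent: "isCont (descent a b) x"
proof -
  have "((\<lambda>y. descent a b y - descent a b x) \<longlongrightarrow> 0) (at x)"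
  proof (rule tendsto_rabs_zero_cancel, rule tendsto_sandwich[where f = "\<lambda>_. 0"])
    show "((\<lambda>y. \<bar>cdf \<mu> y - cdf \<mu> x\<bar>) \<longlongrightarrow> 0) (at x)"
      using isCont_cdf[of x] by (auto simp: isCont_def intro!: tendsto_rabs_zero LIM_zero)
    have "\<bar>descent a b y - descent a b x\<bar> \<le> \<bar>cdf \<mu> y - cdf \<mu> x\<bar>" for y
      using descent_mono[of x y] descent_mono[of y x] descent_increment[of x y] descent_increment[of y x]
      by (cases "x \<le> y") auto
    then show "\<forall>\<^sub>F y in at x. \<bar>descent a b y - descent a b x\<bar> \<le> \<bar>cdf \<mu> y - cdf \<mu> x\<bar>"
      by auto
  qed auto
  then show ?thesis unfolding isCont_def by (rule LIM_zero_cancel)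
qed

definition "descent_measure \<equiv> interval_measure (descent a b)"

lemma descent_measure_Ioc: "x \<le> y \<Longrightarrow> emeasure descent_measure {x<..y} = descent a b y - descent a b x"
  unfolding descent_measure_def
  by (rule emeasure_interval_measure_Ioc[OF _ descent_mono
        continuous_at_imp_continuous_within[OF isCont_descent]])

lemma descent_measure_finite: "finite_borel_measure descent_measure"
  unfolding descent_measure_def
proof (rule finite_borel_measure_interval_measure)
  show "continuous (at_right x) (descent a b)" for x
    by (rule continuous_at_imp_continuous_within[OF isCont_descent])
  have "\<forall>\<^sub>F x in at_bot. descent a b x = 0"
    using \<open>a < b\<close> by (intro eventually_at_bot_linorderI[of a]) (auto simp: descent_def min_def max_def)
  then show "(descent a b \<longlongrightarrow> 0) at_bot"
    by (rule tendsto_eventually)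
  have "\<forall>\<^sub>F x in at_top. descent a b x = run_max b a - run_max b b"
    using \<open>a < b\<close> by (intro eventually_at_top_linorderI[of b]) (auto simp: descent_def min_def max_def)
  then show "(descent a b \<longlongrightarrow> run_max b a - run_max b b) at_top"
    by (rule tendsto_eventually)
  show "0 \<le> run_max b a - run_max b b"
    using \<open>a < b\<close> run_max_antimono[of a b b] by simp
qed (rule descent_mono)

interpretation descent_measure: finite_borel_measure descent_measure
  by (rule descent_measure_finite)

lemma descent_measure_le: "E \<in> sets borel \<Longrightarrow> emeasure descent_measure E \<le> emeasure \<mu> E"
proof -
  assume E: "E \<in> sets borel"
  have "emeasure descent_measure E \<le> emeasure \<mu> E + emeasure (null_measure borel) E"
  proof (rule borel_Ioc_domination)
    show "finite_borel_measure (null_measure borel)"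
      by (intro finite_borel_measure.intro finite_measureI finite_borel_measure_axioms.intro) simp_all
    fix x y :: real assume "x < y"
    then show "emeasure descent_measure {x<..y} \<le> emeasure \<mu> {x<..y} + emeasure (null_measure borel) {x<..y}"
      using descent_increment[of x y] by (auto simp: descent_measure_Ioc \<mu>.emeasure_Ioc intro!: ennreal_leI)
  qed (use E in \<open>auto simp: descent_measure.M_is_borel intro: \<mu>.finite_borel_measure_axioms\<close>)
  then show ?thesis by simp
qed

text \<open>The level set lies between two points with the same value of the distribution function, and
  single points carry no mass because \<open>descent_measure \<le> \<mu>\<close>.\<close>

lemma descent_measure_level_set:
  assumes "q \<in> {a<..<b}"
  shows "emeasure descent_measure {x\<in>{a<..b}. run_max b x = run_max b q} = 0"
proof -
  let ?S = "{x\<in>{a..b}. descent a b x = descent a b q}"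
  have "closed ({x. descent a b x = descent a b q})"
    by (intro closed_Collect_eq continuous_intros continuous_at_imp_continuous_on ballI isCont_descent)
  moreover have S: "?S = {x. descent a b x = descent a b q} \<inter> {a..b}" by auto
  ultimately have compact: "compact ?S"
    unfolding S by (intro closed_Int_compact compact_Icc)
  have "q \<in> ?S" using assms by auto
  then have q: "?S \<noteq> {}" by blast
  obtain y z where y: "y \<in> ?S" "\<And>x. x \<in> ?S \<Longrightarrow> y \<le> x"
    and z: "z \<in> ?S" "\<And>x. x \<in> ?S \<Longrightarrow> x \<le> z"
    using compact_attains_inf[OF compact q] compact_attains_sup[OF compact q] by blast
  have "emeasure descent_measure {y} = 0"
    using descent_measure_le[of "{y}"] atomless by (auto simp: diffuse_def)
  moreover have "emeasure descent_measure {y<..z} = 0"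
    using y z by (subst descent_measure_Ioc) auto
  ultimately have "emeasure descent_measure ({y} \<union> {y<..z}) = 0"
    by (intro emeasure_Un_null_set[THEN trans] null_setsI) (auto simp: descent_measure.M_is_borel)
  moreover have "{x\<in>{a<..b}. run_max b x = run_max b q} \<subseteq> {y} \<union> {y<..z}"
  proof
    fix x assume x: "x \<in> {x\<in>{a<..b}. run_max b x = run_max b q}"
    then have "x \<in> ?S" using assms by (auto simp: descent_def max_def min_def)
    then show "x \<in> {y} \<union> {y<..z}" using y(2)[of x] z(2)[of x] by auto
  qed
  ultimately show ?thesis
    by (metis (lifting) emeasure_mono descent_measure.M_is_borel le_zero_eq sets.Un borel_singleton 
        greaterThanAtMost_borel sets.empty_sets insert_is_Un sets.insert_in_sets descent_measure.sets_M)
qed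

text \<open>One inequality holds because \<open>descent_measure \<le> \<mu>\<close> and because the complement of the ladder
  points is covered by countably many level sets of the running maximum. For the other one, the
  restriction of \<open>\<mu>\<close> to the ladder points is dominated by \<open>descent_measure + \<nu>\<close>: between two
  ladder points \<open>u < v\<close> the running maximum equals \<open>walk\<close> at both ends, so that
  \<open>\<mu> {u<..v} = run_max b u - run_max b v + \<nu> {u<..v}\<close>. Evaluating this domination on a set that
  carries \<open>\<mu>\<close> and is null for \<open>\<nu>\<close> removes the term with \<open>\<nu>\<close>.\<close>

lemma measure_records:
  assumes meas: "records a b \<in> sets borel"
  shows "measure \<mu> (records a b) = run_max b a - walk b"
proof (rule antisym)
  let ?R = "records a b"
  define N where "N = (\<Union>q\<in>\<rat> \<inter> {a<..<b}. {x\<in>{a<..b}. run_max b x = run_max b q})"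
  have level_sets: "{x\<in>{a<..b}. run_max b x = c} \<in> sets borel" for c
  proof -
    have "{x\<in>{a<..b}. run_max b x = c} = {x. descent a b x = run_max b a - c} \<inter> {a<..b}"
      by (auto simp: descent_def max_def min_def)
    moreover have "closed {x. descent a b x = run_max b a - c}"
      by (intro closed_Collect_eq continuous_intros continuous_at_imp_continuous_on ballI isCont_descent)
    ultimately show ?thesis by simp
  qed
  have N: "N \<in> null_sets descent_measure"
    unfolding N_def
    by (intro null_sets_UN' countable_Int1 countable_rat null_setsI descent_measure_level_set)
      (use level_sets in \<open>auto simp: descent_measure.M_is_borel\<close>)
  have "{a<..b} \<subseteq> ?R \<union> N"
  proof
    fix s assume s: "s \<in> {a<..b}"
    show "s \<in> ?R \<union> N"
    proof (cases "s \<in> ?R")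
      case False
      then obtain q where "q \<in> \<rat>" "a < q" "q < b" "run_max b q = run_max b s"
        using run_max_nonrecord[of a s b] s by auto
      then have "s \<in> N" unfolding N_def using s by (intro UN_I[of q]) auto
      then show ?thesis by simp
    qed simp
  qed
  then have "emeasure descent_measure {a<..b} \<le> emeasure descent_measure (?R \<union> N)"
    using N meas by (intro emeasure_mono) (auto simp: descent_measure.M_is_borel)
  also have "\<dots> = emeasure descent_measure ?R"
    using N meas by (intro emeasure_Un_null_set) (auto simp: descent_measure.M_is_borel)
  also have "\<dots> \<le> emeasure \<mu> ?R" by (rule descent_measure_le) fact
  finally have "ennreal (run_max b a - walk b) \<le> ennreal (measure \<mu> ?R)"
    using \<open>a < b\<close> by (simp add: descent_measure_Ioc \<mu>.emeasure_eq_measure descent_def run_max_self)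
  then show "run_max b a - walk b \<le> measure \<mu> ?R" using ennreal_le_iff[OF measure_nonneg] by blast
next
  let ?R = "records a b"
  obtain A where A: "A \<in> sets borel" "emeasure \<mu> (-A) = 0" "emeasure \<nu> A = 0"
    using singular unfolding mutually_singular_def
    by (metis borel_comp double_compl)
  define \<alpha> where "\<alpha> = density \<mu> (indicator ?R)"
  have [simp]: "sets \<alpha> = sets borel" by (simp add: \<alpha>_def \<mu>.M_is_borel)
  have \<alpha>: "emeasure \<alpha> E = emeasure \<mu> (?R \<inter> E)" if "E \<in> sets borel" for E
    unfolding \<alpha>_def using that meas by (intro emeasure_restricted) (simp_all add: \<mu>.M_is_borel)
  have "emeasure \<alpha> (A \<inter> {a<..b}) \<le> emeasure descent_measure (A \<inter> {a<..b}) + emeasure \<nu> (A \<inter> {a<..b})"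
  proof (rule borel_Ioc_domination)
    fix x y :: real assume "x < y"
    define S where "S = ?R \<inter> {x<..y}"
    define K where "K = descent a b y - descent a b x + (cdf \<nu> y - cdf \<nu> x)"
    have "0 \<le> K" using descent_mono[of x y] \<nu>.cdf_nondecreasing[of x y] \<open>x < y\<close> by (simp add: K_def)
    have "emeasure \<mu> S \<le> ennreal K"
    proof (cases "S = {}")
      case False
      have bdd: "bdd_above S" "bdd_below S"
        unfolding S_def by (auto intro: bdd_aboveI[of _ y] bdd_belowI[of _ x])
      have pair: "cdf \<mu> v - cdf \<mu> u \<le> K" if "u \<in> S" "v \<in> S" for u v
      proof (cases "u \<le> v")
        case True
        have uv: "a < u" "v \<le> b" "x < u" "v \<le> y" "u \<in> ?R" "v \<in> ?R"
          using that by (auto simp: S_def records_def)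
        have "cdf \<mu> v - cdf \<mu> u = run_max b u - run_max b v + (cdf \<nu> v - cdf \<nu> u)"
          using uv by (simp add: run_max_record[of _ a] walk_def)
        also have "run_max b u - run_max b v = descent a b v - descent a b u"
          using uv True by (simp add: descent_def max_def min_def)
        also have "\<dots> \<le> descent a b y - descent a b x"
          using uv descent_mono[of v y] descent_mono[of x u] by simp
        also have "cdf \<nu> v - cdf \<nu> u \<le> cdf \<nu> y - cdf \<nu> x"
          using uv \<nu>.cdf_nondecreasing[of v y] \<nu>.cdf_nondecreasing[of x u] by simp
        finally show ?thesis by (simp add: K_def)
      next
        case False
        then have "cdf \<mu> v \<le> cdf \<mu> u" by (intro \<mu>.cdf_nondecreasing) simp
        then show ?thesis using \<open>0 \<le> K\<close> by simp
      qed
      have cont: "continuous_on UNIV (cdf \<mu>)"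
        by (intro continuous_at_imp_continuous_on ballI isCont_cdf)
      \<comment> \<open>The infimum and supremum of \<open>S\<close> need not be ladder points; the estimate passes to them by
        continuity of the distribution function of \<open>\<mu>\<close>.\<close>
      have sup: "cdf \<mu> (Sup S) - cdf \<mu> u \<le> K" if "u \<in> S" for u
      proof -
        have "closed {v. cdf \<mu> v - cdf \<mu> u \<le> K}"
          by (intro closed_Collect_le continuous_intros cont)
        then have "closure S \<subseteq> {v. cdf \<mu> v - cdf \<mu> u \<le> K}"
          using pair[OF that] by (intro closure_minimal) auto
        then show ?thesis using closure_contains_Sup[OF False bdd(1)] by auto
      qed
      have "closed {u. cdf \<mu> (Sup S) - cdf \<mu> u \<le> K}"
        by (intro closed_Collect_le continuous_intros cont)
      then have "closure S \<subseteq> {u. cdf \<mu> (Sup S) - cdf \<mu> u \<le> K}"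
        using sup by (intro closure_minimal) auto
      then have *: "cdf \<mu> (Sup S) - cdf \<mu> (Inf S) \<le> K"
        using closure_contains_Inf[OF False bdd(2)] by auto
      have "emeasure \<mu> S \<le> emeasure \<mu> {Inf S..Sup S}"
        using bdd by (intro emeasure_mono subsetI) (simp_all add: \<mu>.M_is_borel cInf_lower cSup_upper)
      also have "\<dots> \<le> ennreal K"
        using * cInf_le_cSup[OF False bdd] by (simp add: \<mu>.emeasure_eq_measure measure_Icc ennreal_leI)
      finally show ?thesis .
    qed simp
    also have "ennreal K = emeasure descent_measure {x<..y} + emeasure \<nu> {x<..y}"
      using \<open>x < y\<close> descent_mono[of x y] \<nu>.cdf_nondecreasing[of x y]
      by (simp add: descent_measure_Ioc \<nu>.emeasure_Ioc K_def ennreal_plus)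
    finally show "emeasure \<alpha> {x<..y} \<le> emeasure descent_measure {x<..y} + emeasure \<nu> {x<..y}"
      by (simp add: \<alpha> S_def)
  qed (use A in \<open>auto intro: descent_measure_finite \<nu>.finite_borel_measure_axioms\<close>)
  also have "emeasure \<nu> (A \<inter> {a<..b}) = 0"
    using A by (metis Int_lower1 \<nu>.M_is_borel emeasure_mono le_zero_eq)
  also have "emeasure descent_measure (A \<inter> {a<..b}) \<le> emeasure descent_measure {a<..b}"
    by (intro emeasure_mono) (auto simp: descent_measure.M_is_borel)
  finally have "emeasure \<mu> (?R \<inter> A) \<le> ennreal (run_max b a - walk b)"
    using \<open>a < b\<close> A
    by (simp add: descent_measure_Ioc descent_def run_max_self \<alpha>) (simp add: Int_absorb2 Int_left_absorb
        records_def Int_assoc[symmetric] inf.absorb1 subset_eq)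
  moreover have "emeasure \<mu> ?R = emeasure \<mu> (?R \<inter> A)"
  proof (rule emeasure_eq_AE)
    have "AE s in \<mu>. s \<in> A"
      using A by (intro AE_I[of _ _ "- A"]) (auto simp: \<mu>.M_is_borel)
    then show "AE s in \<mu>. s \<in> ?R \<longleftrightarrow> s \<in> ?R \<inter> A" by eventually_elim simp
  qed (use A meas in \<open>auto simp: \<mu>.M_is_borel\<close>)
  ultimately have "ennreal (measure \<mu> ?R) \<le> ennreal (run_max b a - walk b)"
    by (simp add: \<mu>.emeasure_eq_measure)
  moreover have "0 \<le> run_max b a - walk b"
    using \<open>a < b\<close> walk_le_run_max[of a b b] by simp
  ultimately show "measure \<mu> ?R \<le> run_max b a - walk b" by simp
qed

end

end

section \<open>The matching time and its measurability\<close>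

definition match_time :: "real measure \<Rightarrow> real measure \<Rightarrow> real \<Rightarrow> ereal" where
  "match_time \<mu> \<nu> s = Inf (ereal ` {t. s < t \<and> emeasure \<mu> {s..t} \<le> emeasure \<nu> {s..t}})"

lemma first_match_eq: "first_match \<xi> \<eta> \<omega> s = match_time (\<xi> \<omega>) (\<eta> \<omega>) s"
  by (simp add: first_match_def match_time_def)

text \<open>Measurability with respect to the Borel sets is part of the notion, as \<open>locally_finite\<close> alone
  does not determine the \<open>\<sigma>\<close>-algebra.\<close>

definition radon :: "real measure \<Rightarrow> bool" where
  "radon \<mu> \<longleftrightarrow> sets \<mu> = sets borel \<and> locally_finite \<mu>"

lemma radon_sets: "radon \<mu> \<Longrightarrow> sets \<mu> = sets borel"
  by (simp add: radon_def)

lemma radon_finite: "radon \<mu> \<Longrightarrow> A \<subseteq> {a..b} \<Longrightarrow> emeasure \<mu> A < \<infinity>"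
  using emeasure_mono[of A "{a..b}" \<mu>] unfolding radon_def locally_finite_def
  by (metis (no_types, lifting) atLeastAtMost_borel compact_Icc le_less_trans)

lemma radon_right_small:
  assumes "radon \<nu>" "0 < e"
  shows "\<exists>d>0. emeasure \<nu> {t<..t+d} < e"
proof -
  define A where "A n = {t<..t + 1 / real (Suc n)}" for n
  have "(\<lambda>n. emeasure \<nu> (A n)) \<longlonglongrightarrow> emeasure \<nu> (\<Inter>n. A n)"
  proof (rule Lim_emeasure_decseq)
    show "decseq A" unfolding A_def decseq_def by (auto simp: frac_le elim!: order_trans)
    have "A n \<subseteq> {t..t + 1 / real (Suc n)}" for n by (rule subsetI) (simp add: A_def)
    then show "emeasure \<nu> (A n) \<noteq> \<infinity>" for n
      using radon_finite[OF assms(1)] by (metis less_irrefl)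
  qed (auto simp: A_def radon_sets[OF assms(1)])
  also have "(\<Inter>n. A n) = {}"
  proof (rule equals0I)
    fix x assume x: "x \<in> (\<Inter>n. A n)"
    then have "0 < x - t" by (auto simp: A_def)
    then obtain n where "1 / real (Suc n) < x - t" by (rule nat_approx_posE)
    moreover have "x \<in> A n" using x by auto
    ultimately show False by (simp add: A_def)
  qed
  finally have "eventually (\<lambda>n. emeasure \<nu> (A n) < e) sequentially"
    using assms(2) by (intro order_tendstoD(2)) auto
  then obtain n where "emeasure \<nu> (A n) < e"
    using eventually_happens'[OF sequentially_bot] by blast
  then show ?thesis by (intro exI[of _ "1 / real (Suc n)"]) (simp add: A_def)
qed

lemma diffuse_radon_small:
  assumes "radon \<mu>" "diffuse \<mu>" "0 < e"
  shows "\<exists>d>0. emeasure \<mu> {t-d..t+d} < e"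
proof -
  define A where "A n = {t - 1 / real (Suc n)..t + 1 / real (Suc n)}" for n
  have "(\<lambda>n. emeasure \<mu> (A n)) \<longlonglongrightarrow> emeasure \<mu> (\<Inter>n. A n)"
  proof (rule Lim_emeasure_decseq)
    have "1 / real (Suc n) \<le> 1 / real (Suc m)" if "m \<le> n" for m n
      using that by (simp add: frac_le)
    then show "decseq A" unfolding A_def decseq_def by fastforce
    show "emeasure \<mu> (A n) \<noteq> \<infinity>" for n
      using radon_finite[OF assms(1), of "A n" "t - 1 / real (Suc n)" "t + 1 / real (Suc n)"]
      by (auto simp: A_def)
  qed (auto simp: A_def radon_sets[OF assms(1)])
  also have "(\<Inter>n. A n) = {t}"
  proof (intro antisym subsetI)
    fix x assume x: "x \<in> (\<Inter>n. A n)"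
    show "x \<in> {t}"
    proof (rule ccontr)
      assume "x \<notin> {t}"
      then have "0 < \<bar>x - t\<bar>" by auto
      then obtain n where "1 / real (Suc n) < \<bar>x - t\<bar>" by (rule nat_approx_posE)
      moreover have "x \<in> A n" using x by auto
      ultimately show False by (auto simp: A_def)
    qed
  qed (auto simp: A_def)
  also have "emeasure \<mu> {t} = 0" using assms(2) by (simp add: diffuse_def)
  finally have "eventually (\<lambda>n. emeasure \<mu> (A n) < e) sequentially"
    using assms(3) by (intro order_tendstoD(2)) auto
  then obtain n where "emeasure \<mu> (A n) < e"
    using eventually_happens'[OF sequentially_bot] by blast
  then show ?thesis by (intro exI[of _ "1 / real (Suc n)"]) (simp add: A_def)
qed

lemma match_time_ge: "ereal s \<le> match_time \<mu> \<nu> s"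
  unfolding match_time_def by (rule Inf_greatest) auto

lemma match_time_le: "s < t \<Longrightarrow> emeasure \<mu> {s..t} \<le> emeasure \<nu> {s..t} \<Longrightarrow> match_time \<mu> \<nu> s \<le> ereal t"
  unfolding match_time_def by (rule Inf_lower) auto

lemma match_time_less_iff:
  "match_time \<mu> \<nu> s < ereal y \<longleftrightarrow> (\<exists>t. s < t \<and> t < y \<and> emeasure \<mu> {s..t} \<le> emeasure \<nu> {s..t})"
  unfolding match_time_def Inf_less_iff by auto

text \<open>The restriction to \<open>y < d\<close> makes this criterion local: it involves the two measures only on
  intervals \<open>{s..t}\<close> with \<open>t < d\<close>.\<close>

lemma match_time_le_iff_dense:
  assumes "x < d"
  shows "match_time \<mu> \<nu> s \<le> ereal x \<longleftrightarrow>
    (\<forall>y. x < y \<and> y < d \<longrightarrow> (\<exists>t. s < t \<and> t < y \<and> emeasure \<mu> {s..t} \<le> emeasure \<nu> {s..t}))"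
proof
  assume "match_time \<mu> \<nu> s \<le> ereal x"
  then have "match_time \<mu> \<nu> s < ereal y" if "x < y" for y
    using that by (meson ereal_less_eq(3) less_ereal.simps(1) order_le_less_trans)
  then show "\<forall>y. x < y \<and> y < d \<longrightarrow> (\<exists>t. s < t \<and> t < y \<and> emeasure \<mu> {s..t} \<le> emeasure \<nu> {s..t})"
    by (simp add: match_time_less_iff)
next
  assume *: "\<forall>y. x < y \<and> y < d \<longrightarrow> (\<exists>t. s < t \<and> t < y \<and> emeasure \<mu> {s..t} \<le> emeasure \<nu> {s..t})"
  show "match_time \<mu> \<nu> s \<le> ereal x"
  proof (rule ccontr)
    assume "\<not> match_time \<mu> \<nu> s \<le> ereal x"
    then have "ereal x < min (match_time \<mu> \<nu> s) (ereal d)" using assms by simp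
    then obtain y where y: "ereal x < ereal y" "ereal y < min (match_time \<mu> \<nu> s) (ereal d)"
      using ereal_dense2 by blast
    then have "x < y" "y < d" by auto
    then have "match_time \<mu> \<nu> s < ereal y"
      using * by (simp add: match_time_less_iff)
    then show False using less_trans[OF _ y(2)] by fastforce
  qed
qed

text \<open>The distribution functions are right-continuous, so that a sequence of admissible times
  decreasing to \<open>b\<close> makes \<open>b\<close> itself admissible.\<close>

lemma match_time_le_iff:
  assumes "radon \<mu>" "radon \<nu>" "s < b"
  shows "match_time \<mu> \<nu> s \<le> ereal b \<longleftrightarrow> (\<exists>t\<in>{s<..b}. emeasure \<mu> {s..t} \<le> emeasure \<nu> {s..t})"
proof
  assume le: "match_time \<mu> \<nu> s \<le> ereal b"
  show "\<exists>t\<in>{s<..b}. emeasure \<mu> {s..t} \<le> emeasure \<nu> {s..t}"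
  proof (rule ccontr)
    assume no: "\<not> ?thesis"
    have "emeasure \<mu> {s..b} \<le> emeasure \<nu> {s..b}"
    proof (rule ennreal_le_epsilon)
      fix e :: real assume "0 < e"
      then obtain d where d: "0 < d" "emeasure \<nu> {b<..b+d} < ennreal e"
        using radon_right_small[OF assms(2), of "ennreal e" b] by auto
      have "match_time \<mu> \<nu> s < ereal (b + d)"
        using le d(1) by (rule_tac le_less_trans) auto
      then obtain t where t: "s < t" "t < b + d" "emeasure \<mu> {s..t} \<le> emeasure \<nu> {s..t}"
        by (auto simp: match_time_less_iff)
      then have "b < t" using no by fastforce
      have "emeasure \<mu> {s..b} \<le> emeasure \<mu> {s..t}"
        using \<open>b < t\<close> by (intro emeasure_mono) (auto simp: radon_sets[OF assms(1)])
      also have "\<dots> \<le> emeasure \<nu> {s..t}" by fact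
      also have "\<dots> \<le> emeasure \<nu> ({s..b} \<union> {b<..b+d})"
        using t(2) by (intro emeasure_mono) (auto simp: radon_sets[OF assms(2)])
      also have "\<dots> \<le> emeasure \<nu> {s..b} + emeasure \<nu> {b<..b+d}"
        by (intro emeasure_subadditive) (auto simp: radon_sets[OF assms(2)])
      also have "\<dots> \<le> emeasure \<nu> {s..b} + ennreal e"
        using d(2) by (intro add_left_mono less_imp_le)
      finally show "emeasure \<mu> {s..b} \<le> emeasure \<nu> {s..b} + ennreal e" .
    qed
    then show False using no assms(3) by auto
  qed
next
  assume "\<exists>t\<in>{s<..b}. emeasure \<mu> {s..t} \<le> emeasure \<nu> {s..t}"
  then obtain t where t: "s < t" "t \<le> b" "emeasure \<mu> {s..t} \<le> emeasure \<nu> {s..t}"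
    by auto
  have "match_time \<mu> \<nu> s \<le> ereal t" using t by (intro match_time_le)
  also have "\<dots> \<le> ereal b" using t by simp
  finally show "match_time \<mu> \<nu> s \<le> ereal b" .
qed

text \<open>For a locally finite measure this is the mass of \<open>{s..q}\<close>. Written with rational end points on
  the left, it is jointly measurable in the realisation and in \<open>s\<close>, also at realisations that are not
  locally finite.\<close>

definition left_mass :: "real measure \<Rightarrow> real \<Rightarrow> real \<Rightarrow> ennreal" where
  "left_mass \<mu> s q = (INF r\<in>\<rat>. if r \<le> s then emeasure \<mu> {r..q} else \<infinity>)"

lemma left_mass_eq:
  assumes "radon \<mu>"
  shows "left_mass \<mu> s q = emeasure \<mu> {s..q}"
proof (rule antisym)
  define A where "A n = {s - 1 / real (Suc n)..q}" for n
  have frac: "1 / real (Suc n) \<le> 1 / real (Suc m)" if "m \<le> n" for m n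
    using that by (simp add: frac_le)
  have "(\<lambda>n. emeasure \<mu> (A n)) \<longlonglongrightarrow> emeasure \<mu> (\<Inter>n. A n)"
  proof (rule Lim_emeasure_decseq)
    show "decseq A" unfolding A_def decseq_def using frac by fastforce
    show "emeasure \<mu> (A n) \<noteq> \<infinity>" for n
      using radon_finite[OF assms(1), of "A n" "s - 1 / real (Suc n)" q] by (auto simp: A_def)
  qed (auto simp: A_def radon_sets[OF assms(1)])
  also have "(\<Inter>n. A n) = {s..q}"
  proof (intro antisym subsetI)
    fix x assume x: "x \<in> (\<Inter>n. A n)"
    then have "x \<le> q" by (auto simp: A_def)
    moreover have "s \<le> x"
    proof (rule ccontr)
      assume "\<not> s \<le> x"
      then have "0 < s - x" by simp
      then obtain n where "1 / real (Suc n) < s - x" by (rule nat_approx_posE)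
      moreover have "x \<in> A n" using x by auto
      ultimately show False by (auto simp: A_def)
    qed
    ultimately show "x \<in> {s..q}" by simp
  next
    fix x assume "x \<in> {s..q}"
    then have "s - 1 / real (Suc n) \<le> x" for n
      by (simp add: diff_le_eq add_increasing2)
    then show "x \<in> (\<Inter>n. A n)" using \<open>x \<in> {s..q}\<close> by (simp add: A_def)
  qed
  finally have lim: "(\<lambda>n. emeasure \<mu> (A n)) \<longlonglongrightarrow> emeasure \<mu> {s..q}" .
  have "left_mass \<mu> s q \<le> emeasure \<mu> (A n)" for n
  proof -
    obtain r where r: "r \<in> \<rat>" "s - 1 / real (Suc n) < r" "r < s"
      using Rats_dense_in_real[of "s - 1 / real (Suc n)" s] by auto
    have "left_mass \<mu> s q \<le> emeasure \<mu> {r..q}"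
      unfolding left_mass_def using r by (intro INF_lower2[of r]) auto
    also have "\<dots> \<le> emeasure \<mu> (A n)"
      using r by (intro emeasure_mono) (auto simp: A_def radon_sets[OF assms])
    finally show ?thesis .
  qed
  then show "left_mass \<mu> s q \<le> emeasure \<mu> {s..q}"
    by (intro LIMSEQ_le_const[OF lim]) auto
  show "emeasure \<mu> {s..q} \<le> left_mass \<mu> s q"
    unfolding left_mass_def
    by (intro INF_greatest) (auto intro!: emeasure_mono simp: radon_sets[OF assms])
qed

text \<open>The matching time expressed by rational times only. Admissible times may all be irrational, for
  instance when the difference of the distribution functions only touches the required level. The
  condition is therefore relaxed by \<open>1 / (n + 1)\<close> on a compact interval \<open>{a..b}\<close>. The bound \<open>s < a\<close>
  keeps the times away from \<open>s\<close>, near which the relaxed condition always holds if \<open>\<mu>\<close> is diffuse.\<close>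

definition rational_match_time :: "real measure \<Rightarrow> real measure \<Rightarrow> real \<Rightarrow> ereal" where
  "rational_match_time \<mu> \<nu> s = (INF b\<in>\<rat>.
     if \<exists>a\<in>\<rat>. s < a \<and> (\<forall>n. \<exists>q\<in>\<rat>. a \<le> q \<and> q \<le> b \<and>
          left_mass \<mu> s q \<le> left_mass \<nu> s q + ennreal (1 / real (Suc n)))
     then ereal b else \<infinity>)"

lemma rational_match_time_ge: "ereal s \<le> rational_match_time \<mu> \<nu> s"
  unfolding rational_match_time_def by (rule INF_greatest) (auto; fastforce)

text \<open>An admissible time \<open>t\<close> satisfies the relaxed condition at rational times slightly to the right.
  Conversely, times that satisfy the relaxed conditions accumulate at some \<open>t\<close> in \<open>{a..b}\<close>, which is
  admissible because \<open>t \<mapsto> \<nu> {s..t} - \<mu> {s..t}\<close> is upper semicontinuous: the measure \<open>\<mu>\<close> is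
  diffuse, and atoms of \<open>\<nu>\<close> are upward jumps.\<close>

lemma rational_match_time_eq:
  assumes \<mu>: "radon \<mu>" "diffuse \<mu>" and \<nu>: "radon \<nu>"
  shows "rational_match_time \<mu> \<nu> s = match_time \<mu> \<nu> s"
proof (rule antisym)
  show "rational_match_time \<mu> \<nu> s \<le> match_time \<mu> \<nu> s"
    unfolding match_time_def
  proof (rule Inf_greatest)
    fix x assume "x \<in> ereal ` {t. s < t \<and> emeasure \<mu> {s..t} \<le> emeasure \<nu> {s..t}}"
    then obtain t where x: "x = ereal t" and t: "s < t" "emeasure \<mu> {s..t} \<le> emeasure \<nu> {s..t}"
      by auto
    have below: "rational_match_time \<mu> \<nu> s \<le> ereal b" if b: "b \<in> \<rat>" "t < b" for b
    proof -
      obtain a where a: "a \<in> \<rat>" "s < a" "a < t" using Rats_dense_in_real[OF t(1)] by auto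
      have "\<exists>q\<in>\<rat>. a \<le> q \<and> q \<le> b \<and> left_mass \<mu> s q \<le> left_mass \<nu> s q + ennreal (1 / real (Suc n))" for n
      proof -
        obtain d where d: "0 < d" "emeasure \<mu> {t<..t+d} < ennreal (1 / real (Suc n))"
          using radon_right_small[OF \<mu>(1), of "ennreal (1 / real (Suc n))" t] by auto
        obtain q where q: "q \<in> \<rat>" "t < q" "q < min b (t + d)"
          using Rats_dense_in_real[of t "min b (t + d)"] d(1) b(2) by auto
        have "emeasure \<mu> {s..q} \<le> emeasure \<mu> ({s..t} \<union> {t<..t+d})"
          using q by (intro emeasure_mono) (auto simp: radon_sets[OF \<mu>(1)])
        also have "\<dots> \<le> emeasure \<mu> {s..t} + emeasure \<mu> {t<..t+d}"
          by (intro emeasure_subadditive) (auto simp: radon_sets[OF \<mu>(1)])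
        also have "\<dots> \<le> emeasure \<nu> {s..t} + ennreal (1 / real (Suc n))"
          by (rule add_mono[OF t(2) less_imp_le[OF d(2)]])
        also have "emeasure \<nu> {s..t} \<le> emeasure \<nu> {s..q}"
          using q by (intro emeasure_mono) (auto simp: radon_sets[OF \<nu>])
        finally have "emeasure \<mu> {s..q} \<le> emeasure \<nu> {s..q} + ennreal (1 / real (Suc n))"
          by (simp add: add_right_mono)
        then show ?thesis
          using q a by (intro bexI[of _ q]) (auto simp: left_mass_eq[OF \<mu>(1)] left_mass_eq[OF \<nu>])
      qed
      then have "\<exists>a\<in>\<rat>. s < a \<and> (\<forall>n. \<exists>q\<in>\<rat>. a \<le> q \<and> q \<le> b \<and>
          left_mass \<mu> s q \<le> left_mass \<nu> s q + ennreal (1 / real (Suc n)))"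
        using a by blast
      then show ?thesis
        unfolding rational_match_time_def
        by (intro INF_lower2[OF b(1)]) (simp only: if_True order_refl)
    qed
    show "rational_match_time \<mu> \<nu> s \<le> x"
    proof (rule ccontr)
      assume "\<not> ?thesis"
      then have "ereal t < rational_match_time \<mu> \<nu> s" by (simp add: x)
      then obtain z where z: "ereal t < ereal z" "ereal z < rational_match_time \<mu> \<nu> s"
        using ereal_dense2 by blast
      then obtain b where b: "b \<in> \<rat>" "t < b" "b < z" using Rats_dense_in_real[of t z] by auto
      have "ereal b < ereal z" using b by simp
      with z(2) have "ereal b < rational_match_time \<mu> \<nu> s" by (rule less_trans[rotated])
      then show False using below[OF b(1,2)] by simp
    qed
  qed
next
  show "match_time \<mu> \<nu> s \<le> rational_match_time \<mu> \<nu> s"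
    unfolding rational_match_time_def
  proof (rule INF_greatest)
    fix b :: real
    have "match_time \<mu> \<nu> s \<le> ereal b"
      if "s < a" and ex: "\<And>n. \<exists>q\<in>\<rat>. a \<le> q \<and> q \<le> b \<and>
        left_mass \<mu> s q \<le> left_mass \<nu> s q + ennreal (1 / real (Suc n))" for a
    proof -
      obtain q where q: "\<And>n. q n \<in> {a..b}"
        "\<And>n. emeasure \<mu> {s..q n} \<le> emeasure \<nu> {s..q n} + ennreal (1 / real (Suc n))"
        using ex unfolding left_mass_eq[OF \<mu>(1)] left_mass_eq[OF \<nu>] by (metis atLeastAtMost_iff)
      obtain t r where t: "t \<in> {a..b}" and r: "strict_mono r" and lim: "(q \<circ> r) \<longlonglongrightarrow> t"
        using compact_Icc[of a b, unfolded compact_def] q(1) by metis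
      have "emeasure \<mu> {s..t} \<le> emeasure \<nu> {s..t}"
      proof (rule ennreal_le_epsilon)
        fix e :: real assume "0 < e"
        then have e: "0 < ennreal (e/3)" "0 < e/3" by simp_all
        obtain d where d: "0 < d" "emeasure \<mu> {t-d..t+d} < ennreal (e/3)"
          using diffuse_radon_small[OF \<mu> e(1)] by blast
        obtain c where c: "0 < c" "emeasure \<nu> {t<..t+c} < ennreal (e/3)"
          using radon_right_small[OF \<nu> e(1)] by blast
        have "eventually (\<lambda>k. dist ((q \<circ> r) k) t < min d c) sequentially"
          using tendstoD[OF lim, of "min d c"] d(1) c(1) by simp
        moreover have "eventually (\<lambda>k. 1 / real (Suc (r k)) < e/3) sequentially"
        proof -
          have "(\<lambda>n. 1 / real (Suc n)) \<longlonglongrightarrow> 0" using LIMSEQ_inverse_real_of_nat by (simp add: inverse_eq_divide)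
          then have "((\<lambda>n. 1 / real (Suc n)) \<circ> r) \<longlonglongrightarrow> 0"
            using r by (rule LIMSEQ_subseq_LIMSEQ)
          then show ?thesis using e(2) order_tendstoD(2) by (fastforce simp: o_def)
        qed
        ultimately have "eventually (\<lambda>k. dist ((q \<circ> r) k) t < min d c \<and> 1 / real (Suc (r k)) < e/3) sequentially"
          by (rule eventually_conj)
        then obtain k where k: "dist (q (r k)) t < min d c" "1 / real (Suc (r k)) < e/3"
          using eventually_happens'[OF sequentially_bot] by fastforce
        define p where "p = q (r k)"
        have p: "t - d < p" "p < t + c" using k(1) by (auto simp: p_def dist_real_def)
        have "emeasure \<mu> {s..t} \<le> emeasure \<mu> ({s..p} \<union> {t-d..t+d})"
          using p d(1) by (intro emeasure_mono) (auto simp: radon_sets[OF \<mu>(1)])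
        also have "\<dots> \<le> emeasure \<mu> {s..p} + emeasure \<mu> {t-d..t+d}"
          by (intro emeasure_subadditive) (auto simp: radon_sets[OF \<mu>(1)])
        also have "\<dots> \<le> (emeasure \<nu> {s..p} + ennreal (e/3)) + ennreal (e/3)"
        proof (intro add_mono)
          have "emeasure \<mu> {s..p} \<le> emeasure \<nu> {s..p} + ennreal (1 / real (Suc (r k)))"
            unfolding p_def by (rule q(2))
          also have "\<dots> \<le> emeasure \<nu> {s..p} + ennreal (e/3)"
            using k(2) by (intro add_left_mono ennreal_leI less_imp_le)
          finally show "emeasure \<mu> {s..p} \<le> emeasure \<nu> {s..p} + ennreal (e/3)" .
        qed (use d(2) in \<open>rule less_imp_le\<close>)
        also have "emeasure \<nu> {s..p} \<le> emeasure \<nu> ({s..t} \<union> {t<..t+c})"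
          using p by (intro emeasure_mono) (auto simp: radon_sets[OF \<nu>])
        also have "\<dots> \<le> emeasure \<nu> {s..t} + emeasure \<nu> {t<..t+c}"
          by (intro emeasure_subadditive) (auto simp: radon_sets[OF \<nu>])
        also have "\<dots> \<le> emeasure \<nu> {s..t} + ennreal (e/3)"
          using c(2) by (intro add_left_mono less_imp_le)
        finally have "emeasure \<mu> {s..t} \<le> emeasure \<nu> {s..t} + (ennreal (e/3) + ennreal (e/3) + ennreal (e/3))"
          by (simp add: add_right_mono add.assoc)
        also have "ennreal (e/3) + ennreal (e/3) + ennreal (e/3) = ennreal e"
          using e(2) by (simp add: ennreal_plus[symmetric] del: ennreal_plus)
        finally show "emeasure \<mu> {s..t} \<le> emeasure \<nu> {s..t} + ennreal e" .
      qed
      then have "match_time \<mu> \<nu> s \<le> ereal t"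
        using t \<open>s < a\<close> by (intro match_time_le) auto
      also have "\<dots> \<le> ereal b" using t by simp
      finally show ?thesis .
    qed
    then show "match_time \<mu> \<nu> s \<le> (if \<exists>a\<in>\<rat>. s < a \<and> (\<forall>n. \<exists>q\<in>\<rat>. a \<le> q \<and> q \<le> b \<and>
          left_mass \<mu> s q \<le> left_mass \<nu> s q + ennreal (1 / real (Suc n)))
     then ereal b else \<infinity>)"
      by auto
  qed
qed

lemma left_mass_measurable:
  assumes [measurable]: "\<And>C. C \<in> sets borel \<Longrightarrow> (\<lambda>\<omega>. emeasure (\<xi> \<omega>) C) \<in> borel_measurable M"
  shows "(\<lambda>x. left_mass (\<xi> (fst x)) (snd x) q) \<in> borel_measurable (M \<Otimes>\<^sub>M borel)"
proof -
  have [measurable]: "(\<lambda>x. emeasure (\<xi> (fst x)) {r..q}) \<in> borel_measurable (M \<Otimes>\<^sub>M borel)" for r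
    using measurable_compose[OF measurable_fst assms[of "{r..q}"]] by simp
  show ?thesis
    unfolding left_mass_def by (intro borel_measurable_INF countable_rat) measurable
qed

lemma rational_match_time_measurable:
  fixes M :: "'a measure"
  assumes \<xi>: "\<And>C. C \<in> sets borel \<Longrightarrow> (\<lambda>\<omega>. emeasure (\<xi> \<omega>) C) \<in> borel_measurable M"
    and \<eta>: "\<And>C. C \<in> sets borel \<Longrightarrow> (\<lambda>\<omega>. emeasure (\<eta> \<omega>) C) \<in> borel_measurable M"
  shows "(\<lambda>(\<omega>, s). rational_match_time (\<xi> \<omega>) (\<eta> \<omega>) s) \<in> borel_measurable (M \<Otimes>\<^sub>M borel)"
proof -
  have [measurable]: "(\<lambda>x. left_mass (\<xi> (fst x)) (snd x) q) \<in> borel_measurable (M \<Otimes>\<^sub>M borel)"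
    "(\<lambda>x. left_mass (\<eta> (fst x)) (snd x) q) \<in> borel_measurable (M \<Otimes>\<^sub>M borel)" for q
    using left_mass_measurable[of \<xi> M] left_mass_measurable[of \<eta> M] \<xi> \<eta> by blast+
  have ex_rat: "Measurable.pred (M \<Otimes>\<^sub>M borel) (\<lambda>x. \<exists>q\<in>\<rat>. P q x)"
    if "\<And>q. Measurable.pred (M \<Otimes>\<^sub>M borel) (P q)" for P :: "real \<Rightarrow> 'a \<times> real \<Rightarrow> bool"
    using that unfolding pred_def by (intro sets.sets_Collect_countable_Ex' countable_rat)
  have [measurable]: "Measurable.pred (M \<Otimes>\<^sub>M borel) (\<lambda>x. \<exists>a\<in>\<rat>. snd x < a \<and> (\<forall>n. \<exists>q\<in>\<rat>. a \<le> q \<and> q \<le> b \<and>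
          left_mass (\<xi> (fst x)) (snd x) q \<le> left_mass (\<eta> (fst x)) (snd x) q + ennreal (1 / real (Suc n))))" for b
    by (intro ex_rat pred_intros_countable pred_intros_logic) measurable
  show ?thesis
    unfolding rational_match_time_def split_beta' by (intro borel_measurable_INF countable_rat) measurable
qed

lemma match_time_measurable:
  assumes "radon \<mu>" "diffuse \<mu>" "radon \<nu>"
  shows "match_time \<mu> \<nu> \<in> borel_measurable borel"
proof -
  have "(\<lambda>(\<omega>, s). rational_match_time \<mu> \<nu> s) \<in> borel_measurable (count_space UNIV \<Otimes>\<^sub>M borel)"
    by (rule rational_match_time_measurable) auto
  then have "(\<lambda>s. case ((), s) of (\<omega>, s) \<Rightarrow> rational_match_time \<mu> \<nu> s) \<in> borel_measurable borel"
    by (rule measurable_compose[rotated]) simp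
  then show ?thesis by (simp add: rational_match_time_eq[OF assms])
qed

section \<open>The image of a diffuse measure under the matching\<close>

lemma (in finite_borel_measure) radon: "radon M"
  unfolding radon_def locally_finite_def by (simp add: M_is_borel less_top[symmetric])

context finite_singular_pair
begin

lemma match_time_borel: "match_time \<mu> \<nu> \<in> borel_measurable borel"
  by (intro match_time_measurable \<mu>.radon \<nu>.radon atomless)

lemma late_mass:
  assumes "c < b"
  shows "measure \<mu> {s\<in>{c<..b}. ereal b < match_time \<mu> \<nu> s} = run_max b c - walk b"
proof -
  let ?L = "{s\<in>{c<..b}. ereal b < match_time \<mu> \<nu> s}"
  have L: "?L \<in> sets borel"
    using match_time_borel by measurable
  have R: "records c b = (?L - {b}) \<union> {b}"
  proof (rule set_eqI)
    fix s
    show "s \<in> records c b \<longleftrightarrow> s \<in> (?L - {b}) \<union> {b}"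
    proof (cases "s \<in> {c<..<b}")
      case True
      then have "ereal b < match_time \<mu> \<nu> s \<longleftrightarrow>
          \<not> (\<exists>t\<in>{s<..b}. emeasure \<mu> {s..t} \<le> emeasure \<nu> {s..t})"
        using match_time_le_iff[OF \<mu>.radon \<nu>.radon, of s b] by (simp only: not_le[symmetric]) simp
      then show ?thesis using True by (auto simp: records_def not_le)
    next
      case False
      then show ?thesis using assms by (auto simp: records_def)
    qed
  qed
  then have R_borel: "records c b \<in> sets borel" using L by auto
  have "AE s in \<mu>. s \<noteq> b"
    using atomless by (intro AE_I[of _ _ "{b}"]) (auto simp: diffuse_def \<mu>.M_is_borel)
  then have "AE s in \<mu>. s \<in> ?L \<longleftrightarrow> s \<in> records c b"
    by eventually_elim (auto simp: R)
  then have "measure \<mu> ?L = measure \<mu> (records c b)"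
    by (rule \<mu>.finite_measure_eq_AE) (use L R_borel in \<open>simp_all only: \<mu>.M_is_borel\<close>)
  then show ?thesis using measure_records[OF assms R_borel] by simp
qed

text \<open>Mass of \<open>{c<..b}\<close> that is matched in \<open>{a<..b}\<close>, or after \<open>b\<close>, is the same as mass of \<open>{c<..a}\<close>
  matched after \<open>a\<close>, or mass in \<open>{a<..b}\<close>. The masses matched late are given by \<open>late_mass\<close>, and the
  values of \<open>walk\<close> combine with \<open>\<mu> {a<..b}\<close> to \<open>\<nu> {a<..b}\<close>.\<close>

lemma window_mass:
  assumes "c < a" "a < b"
  shows "measure \<mu> {s\<in>{c<..b}. ereal a < match_time \<mu> \<nu> s \<and> match_time \<mu> \<nu> s \<le> ereal b}
    = measure \<nu> {a<..b} - (run_max b c - run_max a c)"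
proof -
  let ?L = "\<lambda>b. {s\<in>{c<..b}. ereal b < match_time \<mu> \<nu> s}"
  let ?X = "{s\<in>{c<..b}. ereal a < match_time \<mu> \<nu> s \<and> match_time \<mu> \<nu> s \<le> ereal b}"
  have meas: "?L x \<in> sets \<mu>" "?X \<in> sets \<mu>" for x
    using match_time_borel unfolding \<mu>.M_is_borel by measurable
  have late: "ereal a < match_time \<mu> \<nu> s" if "a < s" for s
    using that match_time_ge[of s \<mu> \<nu>] by (meson ereal_less(2) less_ereal.simps(1) less_le_trans)
  have "measure \<mu> ?X + measure \<mu> (?L b) = measure \<mu> (?X \<union> ?L b)"
    using meas by (intro \<mu>.finite_measure_Union[symmetric]) auto
  also have "?X \<union> ?L b = ?L a \<union> {a<..b}"
    using assms late by (auto intro: less_trans[of "ereal a" "ereal b"] less_imp_le)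
  also have "measure \<mu> \<dots> = measure \<mu> (?L a) + measure \<mu> {a<..b}"
    using meas by (intro \<mu>.finite_measure_Union) auto
  finally have "measure \<mu> ?X = measure \<mu> (?L a) + measure \<mu> {a<..b} - measure \<mu> (?L b)"
    by simp
  then show ?thesis
    using assms late_mass[of c a] late_mass[of c b] \<mu>.cdf_diff_eq[OF assms(2)] \<nu>.cdf_diff_eq[OF assms(2)]
    by (simp add: walk_def)
qed

end

locale radon_singular_pair =
  fixes \<mu> \<nu> :: "real measure"
  assumes \<mu>: "radon \<mu>" and \<nu>: "radon \<nu>"
    and atomless: "diffuse \<mu>" and singular: "mutually_singular \<mu> \<nu>"
begin

lemma match_time_borel: "match_time \<mu> \<nu> \<in> borel_measurable borel"
  by (intro match_time_measurable \<mu> \<nu> atomless)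

lemma window_borel: "{s\<in>{c<..b}. ereal a < match_time \<mu> \<nu> s \<and> match_time \<mu> \<nu> s \<le> ereal b} \<in> sets borel"
  using match_time_borel by measurable

text \<open>Both measures are restricted to \<open>{c<..b+1}\<close>, where they are finite. The margin to the right of
  \<open>b\<close> ensures that this does not change which matching times are at most \<open>b\<close>.\<close>

lemma window:
  assumes "c < a" "a < b"
  defines "X \<equiv> {s\<in>{c<..b}. ereal a < match_time \<mu> \<nu> s \<and> match_time \<mu> \<nu> s \<le> ereal b}"
  shows window_le: "emeasure \<mu> X \<le> emeasure \<nu> {a<..b}"
    and window_eq: "match_time \<mu> \<nu> c = \<infinity> \<Longrightarrow> emeasure \<mu> X = emeasure \<nu> {a<..b}"
proof -
  define I where "I = {c<..b+1}"
  define \<mu>' \<nu>' where "\<mu>' = density \<mu> (indicator I)" and "\<nu>' = density \<nu> (indicator I)"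
  have I: "I \<in> sets borel" by (simp add: I_def)
  have \<mu>'_eq: "emeasure \<mu>' A = emeasure \<mu> (I \<inter> A)" if "A \<in> sets borel" for A
    unfolding \<mu>'_def using that I by (intro emeasure_restricted) (auto simp: radon_sets[OF \<mu>])
  have \<nu>'_eq: "emeasure \<nu>' A = emeasure \<nu> (I \<inter> A)" if "A \<in> sets borel" for A
    unfolding \<nu>'_def using that I by (intro emeasure_restricted) (auto simp: radon_sets[OF \<nu>])
  have I_fin: "emeasure \<mu> I < \<infinity>" "emeasure \<nu> I < \<infinity>"
    using radon_finite[OF \<mu>, of I c "b+1"] radon_finite[OF \<nu>, of I c "b+1"]
    by (simp_all add: I_def subset_eq)
  have sets': "sets \<mu>' = sets borel" "sets \<nu>' = sets borel"
    by (simp_all add: \<mu>'_def \<nu>'_def radon_sets \<mu> \<nu>)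
  have space': "space \<mu>' = UNIV" "space \<nu>' = UNIV"
    using sets'[THEN sets_eq_imp_space_eq] by simp_all
  interpret \<mu>': finite_borel_measure \<mu>'
    by (intro finite_borel_measure.intro finite_measureI finite_borel_measure_axioms.intro sets')
      (use I_fin \<mu>'_eq[of UNIV] in \<open>simp add: space'\<close>)
  interpret \<nu>': finite_borel_measure \<nu>'
    by (intro finite_borel_measure.intro finite_measureI finite_borel_measure_axioms.intro sets')
      (use I_fin \<nu>'_eq[of UNIV] in \<open>simp add: space'\<close>)
  have single: "emeasure \<mu> {t} = 0" for t using atomless by (simp add: diffuse_def)
  interpret finite_singular_pair \<mu>' \<nu>'
  proof
    show "diffuse \<mu>'"
      unfolding diffuse_def
    proof
      fix t
      have "emeasure \<mu> (I \<inter> {t}) \<le> emeasure \<mu> {t}"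
        by (intro emeasure_mono) (auto simp: radon_sets[OF \<mu>])
      then show "emeasure \<mu>' {t} = 0" by (simp add: \<mu>'_eq single)
    qed
    obtain A where A: "A \<in> sets borel" "emeasure \<mu> A = 0" "emeasure \<nu> (-A) = 0"
      using singular unfolding mutually_singular_def by blast
    have "emeasure \<mu> (I \<inter> A) \<le> emeasure \<mu> A" "emeasure \<nu> (I \<inter> -A) \<le> emeasure \<nu> (-A)"
      using A(1) by (auto intro!: emeasure_mono simp: radon_sets[OF \<mu>] radon_sets[OF \<nu>] borel_comp)
    then show "mutually_singular \<mu>' \<nu>'"
      unfolding mutually_singular_def using A by (intro bexI[of _ A]) (auto simp: \<mu>'_eq \<nu>'_eq borel_comp)
  qed
  have local: "emeasure \<mu>' A = emeasure \<mu> A" "emeasure \<nu>' A = emeasure \<nu> A"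
    if "A \<in> sets borel" "A \<subseteq> I" for A
    using that by (simp_all add: \<mu>'_eq \<nu>'_eq Int_absorb1)
  have match: "match_time \<mu>' \<nu>' s \<le> ereal x \<longleftrightarrow> match_time \<mu> \<nu> s \<le> ereal x" if "c < s" "x \<le> b" for s x
  proof -
    have "emeasure \<mu>' {s..t} = emeasure \<mu> {s..t}" "emeasure \<nu>' {s..t} = emeasure \<nu> {s..t}" if "t < b + 1" for t
      using that \<open>c < s\<close> by (auto intro!: local simp: I_def)
    then have iff: "(\<exists>t. s < t \<and> t < y \<and> emeasure \<mu>' {s..t} \<le> emeasure \<nu>' {s..t}) \<longleftrightarrow>
        (\<exists>t. s < t \<and> t < y \<and> emeasure \<mu> {s..t} \<le> emeasure \<nu> {s..t})" if "y < b + 1" for y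
      using less_trans[OF _ that] by auto
    have "x < b + 1" using that by simp
    show ?thesis
      unfolding match_time_le_iff_dense[OF \<open>x < b + 1\<close>] using iff by blast
  qed
  have X': "X = {s\<in>{c<..b}. ereal a < match_time \<mu>' \<nu>' s \<and> match_time \<mu>' \<nu>' s \<le> ereal b}"
    unfolding X_def using assms by (auto simp: match not_le[symmetric])
  have X: "X \<in> sets borel" unfolding X_def by (rule window_borel)
  have "X \<subseteq> I" by (auto simp: X_def I_def)
  then have \<mu>X: "emeasure \<mu> X = measure \<mu>' X"
    using local[OF X] by (simp add: \<mu>'.emeasure_eq_measure)
  have \<nu>I: "emeasure \<nu> {a<..b} = measure \<nu>' {a<..b}"
    using local[of "{a<..b}"] assms by (simp add: \<nu>'.emeasure_eq_measure I_def subset_eq)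
  have mass: "measure \<mu>' X = measure \<nu>' {a<..b} - (run_max b c - run_max a c)"
    unfolding X' by (rule window_mass) fact+
  show "emeasure \<mu> X \<le> emeasure \<nu> {a<..b}"
    unfolding \<mu>X \<nu>I mass using run_max_mono[of c a b] assms by (intro ennreal_leI) simp
  \<comment> \<open>If \<open>c\<close> is never matched, \<open>walk\<close> stays below its value at \<open>c\<close>, so that both running maxima
    in the formula for the window are this value.\<close>
  assume inf: "match_time \<mu> \<nu> c = \<infinity>"
  have "walk t \<le> walk c" if "c \<le> t" "t \<le> b" for t
  proof (cases "t = c")
    case False
    then have "c < t" using that by simp
    then have *: "emeasure \<nu> {c..t} < emeasure \<mu> {c..t}"
      using match_time_le[of c t \<mu> \<nu>] inf by (auto simp: not_le[symmetric])
    have "emeasure \<nu>' {c<..t} = emeasure \<nu> {c<..t}"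
      using that by (intro local) (auto simp: I_def)
    also have "\<dots> \<le> emeasure \<nu> {c..t}"
      by (intro emeasure_mono) (auto simp: radon_sets[OF \<nu>])
    also have "\<dots> \<le> emeasure \<mu> {c..t}"
      using * by (rule less_imp_le)
    also have "{c..t} = {c} \<union> {c<..t}"
      using \<open>c < t\<close> by auto
    also have "emeasure \<mu> \<dots> \<le> emeasure \<mu> {c} + emeasure \<mu> {c<..t}"
      by (intro emeasure_subadditive) (auto simp: radon_sets[OF \<mu>])
    also have "\<dots> = emeasure \<mu>' {c<..t}"
      using that by (subst local) (auto simp: I_def single)
    finally have "measure \<nu>' {c<..t} \<le> measure \<mu>' {c<..t}"
      by (simp add: \<nu>'.emeasure_eq_measure \<mu>'.emeasure_eq_measure)
    then show ?thesis
      using \<mu>'.cdf_diff_eq[OF \<open>c < t\<close>] \<nu>'.cdf_diff_eq[OF \<open>c < t\<close>] by (simp add: walk_def)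
  qed simp
  then have "run_max y c = walk c" if "c \<le> y" "y \<le> b" for y
    using that by (intro antisym run_max_least walk_le_run_max) auto
  then have "run_max b c = run_max a c" using assms by simp
  then show "emeasure \<mu> X = emeasure \<nu> {a<..b}"
    unfolding \<mu>X \<nu>I mass by simp
qed

lemma matched_borel: "{s. ereal a < match_time \<mu> \<nu> s \<and> match_time \<mu> \<nu> s \<le> ereal b} \<in> sets borel"
  using match_time_borel by measurable

lemma matched_mass_le:
  assumes "a < b"
  shows "emeasure \<mu> {s. ereal a < match_time \<mu> \<nu> s \<and> match_time \<mu> \<nu> s \<le> ereal b} \<le> emeasure \<nu> {a<..b}"
proof -
  define X where "X n = {s\<in>{a - real (Suc n)<..b}. ereal a < match_time \<mu> \<nu> s \<and> match_time \<mu> \<nu> s \<le> ereal b}" for n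
  have X: "{s. ereal a < match_time \<mu> \<nu> s \<and> match_time \<mu> \<nu> s \<le> ereal b} = (\<Union>n. X n)"
  proof (intro antisym subsetI)
    fix s assume s: "s \<in> {s. ereal a < match_time \<mu> \<nu> s \<and> match_time \<mu> \<nu> s \<le> ereal b}"
    obtain n where "a - s < real n" using reals_Archimedean2 by blast
    moreover have "ereal s \<le> ereal b" using order_trans[OF match_time_ge] s by blast
    ultimately show "s \<in> (\<Union>n. X n)" using s by (auto simp: X_def intro!: exI[of _ n])
  qed (auto simp: X_def)
  have "emeasure \<mu> (\<Union>n. X n) = (SUP n. emeasure \<mu> (X n))"
  proof (rule SUP_emeasure_incseq[symmetric])
    show "range X \<subseteq> sets \<mu>"
      using window_borel unfolding radon_sets[OF \<mu>] X_def by blast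
    show "incseq X"
      unfolding incseq_def X_def by auto
  qed
  also have "\<dots> \<le> emeasure \<nu> {a<..b}"
    unfolding X_def by (intro SUP_least window_le) (use assms in auto)
  finally show ?thesis by (simp only: X)
qed

lemma matched_mass_eq:
  assumes "a < b" "c < a" "match_time \<mu> \<nu> c = \<infinity>"
  shows "emeasure \<mu> {s. ereal a < match_time \<mu> \<nu> s \<and> match_time \<mu> \<nu> s \<le> ereal b} = emeasure \<nu> {a<..b}"
proof (rule antisym)
  show "emeasure \<nu> {a<..b} \<le> emeasure \<mu> {s. ereal a < match_time \<mu> \<nu> s \<and> match_time \<mu> \<nu> s \<le> ereal b}"
    unfolding window_eq[OF assms(2,1,3), symmetric]
    by (intro emeasure_mono) (auto simp: radon_sets[OF \<mu>] matched_borel)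
qed (rule matched_mass_le[OF assms(1)])

end

section \<open>Stationary ergodic flows\<close>

text \<open>On a bounded window the kernel is finite, so that the class of sets for which the claim holds is
  closed under complements; the general case follows by exhausting the line.\<close>

lemma kernel_section_measurable:
  fixes \<kappa> :: "'a \<Rightarrow> real measure"
  assumes radon: "\<And>\<omega>. \<omega> \<in> space M \<Longrightarrow> radon (\<kappa> \<omega>)"
    and meas: "\<And>C. C \<in> sets borel \<Longrightarrow> (\<lambda>\<omega>. emeasure (\<kappa> \<omega>) C) \<in> borel_measurable M"
    and D: "D \<in> sets (M \<Otimes>\<^sub>M borel)"
  shows "(\<lambda>\<omega>. emeasure (\<kappa> \<omega>) (Pair \<omega> -` D)) \<in> borel_measurable M"
proof -
  define I where "I n = {- real n..real n}" for n
  have sets: "sets (\<kappa> \<omega>) = sets borel" if "\<omega> \<in> space M" for \<omega>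
    using radon[OF that] by (rule radon_sets)
  have slice: "Pair \<omega> -` D \<in> sets borel" if "D \<in> sets (M \<Otimes>\<^sub>M borel)" for D :: "('a \<times> real) set" and \<omega>
    using that by (rule sets_Pair1)
  have window: "(\<lambda>\<omega>. emeasure (\<kappa> \<omega>) (I n \<inter> Pair \<omega> -` D)) \<in> borel_measurable M" for n
  proof -
    have "D \<in> sigma_sets (space M \<times> space borel) {a \<times> b |a b. a \<in> sets M \<and> b \<in> sets borel}"
      using D by (simp add: sets_pair_measure)
    with Int_stable_pair_measure_generator pair_measure_closed show ?thesis
    proof (induct rule: sigma_sets_induct_disjoint)
      case (basic A)
      then obtain a b where A: "A = a \<times> b" "a \<in> sets M" "b \<in> sets borel" by auto
      have "emeasure (\<kappa> \<omega>) (I n \<inter> Pair \<omega> -` A) = indicator a \<omega> * emeasure (\<kappa> \<omega>) (I n \<inter> b)" for \<omega>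
        by (cases "\<omega> \<in> a") (auto simp: A(1) vimage_def)
      then show ?case using A(2,3) meas[of "I n \<inter> b"] by (simp add: I_def)
    next
      case empty
      then show ?case by simp
    next
      case (compl A)
      have A: "A \<in> sets (M \<Otimes>\<^sub>M borel)" using compl(1) by (simp add: sets_pair_measure)
      have "emeasure (\<kappa> \<omega>) (I n \<inter> Pair \<omega> -` (space M \<times> space borel - A)) =
          emeasure (\<kappa> \<omega>) (I n) - emeasure (\<kappa> \<omega>) (I n \<inter> Pair \<omega> -` A)" if \<omega>: "\<omega> \<in> space M" for \<omega>
      proof -
        have "I n \<inter> Pair \<omega> -` (space M \<times> space borel - A) = I n - I n \<inter> Pair \<omega> -` A"
          using \<omega> by auto
        moreover have "emeasure (\<kappa> \<omega>) (I n \<inter> Pair \<omega> -` A) \<noteq> \<infinity>"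
          using radon_finite[OF radon[OF \<omega>], of "I n \<inter> Pair \<omega> -` A" "- real n" "real n"]
          by (auto simp: I_def)
        ultimately show ?thesis
          using slice[OF A, of \<omega>] by (simp only:) (rule emeasure_Diff, auto simp: sets[OF \<omega>] I_def)
      qed
      note eq = this
      note [measurable] = compl(2)
      have [measurable]: "(\<lambda>\<omega>. emeasure (\<kappa> \<omega>) (I n)) \<in> borel_measurable M"
        by (intro meas) (simp add: I_def)
      show ?case
        by (subst measurable_cong[OF eq]) measurable
    next
      case (union F)
      have F: "F i \<in> sets (M \<Otimes>\<^sub>M borel)" for i using union(2) by (auto simp: sets_pair_measure)
      have "emeasure (\<kappa> \<omega>) (I n \<inter> Pair \<omega> -` (\<Union>i. F i)) = (\<Sum>i. emeasure (\<kappa> \<omega>) (I n \<inter> Pair \<omega> -` F i))"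
        if \<omega>: "\<omega> \<in> space M" for \<omega>
      proof -
        have "I n \<inter> Pair \<omega> -` (\<Union>i. F i) = (\<Union>i. I n \<inter> Pair \<omega> -` F i)" by auto
        moreover have "disjoint_family (\<lambda>i. I n \<inter> Pair \<omega> -` F i)"
          using union(1) unfolding disjoint_family_on_def by blast
        ultimately show ?thesis
          using slice[OF F]
          by (simp only:) (rule suminf_emeasure[symmetric], auto simp: sets[OF \<omega>] I_def)
      qed
      note eq = this
      note [measurable] = union(3)
      show ?case
        by (subst measurable_cong[OF eq]) measurable
    qed
  qed
  have "emeasure (\<kappa> \<omega>) (Pair \<omega> -` D) = (SUP n. emeasure (\<kappa> \<omega>) (I n \<inter> Pair \<omega> -` D))"
    if \<omega>: "\<omega> \<in> space M" for \<omega>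
  proof -
    have cover: "Pair \<omega> -` D = (\<Union>n. I n \<inter> Pair \<omega> -` D)"
    proof -
      have "\<exists>n. x \<in> I n" for x
      proof -
        obtain n where "\<bar>x\<bar> \<le> real n" using real_arch_simple by blast
        then show ?thesis by (intro exI[of _ n]) (simp add: I_def abs_le_iff)
      qed
      then show ?thesis by auto
    qed
    have "incseq (\<lambda>n. I n \<inter> Pair \<omega> -` D)"
      unfolding incseq_def I_def by auto
    then show ?thesis
      using slice[OF D, of \<omega>] by (subst cover) (intro SUP_emeasure_incseq[symmetric], auto simp: sets[OF \<omega>] I_def)
  qed
  note eq = this
  note [measurable] = window
  show ?thesis
    by (subst measurable_cong[OF eq]) measurable
qed

lemma borel_measurable_int_sum:
  fixes f :: "int \<Rightarrow> 'a \<Rightarrow> ennreal"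
  assumes [measurable]: "\<And>n. f n \<in> borel_measurable M"
  shows "(\<lambda>x. \<integral>\<^sup>+n. f n x \<partial>count_space UNIV) \<in> borel_measurable M"
proof -
  have bij: "bij_betw (from_nat_into (UNIV :: int set)) UNIV UNIV"
    by (rule bij_betw_from_nat_into) (auto simp: infinite_UNIV_int)
  have "(\<integral>\<^sup>+n. f n x \<partial>count_space UNIV) = (\<Sum>i. f (from_nat_into UNIV i) x)" for x
    by (simp add: nn_integral_bij_count_space[OF bij, symmetric] nn_integral_count_space_nat)
  then show ?thesis by simp
qed

lemma AE_eq_of_nn_integral_eq:
  assumes [measurable]: "f \<in> borel_measurable M" "g \<in> borel_measurable M"
    and le: "\<And>x. x \<in> space M \<Longrightarrow> f x \<le> g x"
    and eq: "(\<integral>\<^sup>+x. f x \<partial>M) = (\<integral>\<^sup>+x. g x \<partial>M)" and fin: "(\<integral>\<^sup>+x. g x \<partial>M) < \<infinity>"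
  shows "AE x in M. f x = g x"
proof -
  have "AE x in M. g x \<le> f x"
  proof (rule ccontr)
    assume "\<not> (AE x in M. g x \<le> f x)"
    then have "(\<integral>\<^sup>+x. f x \<partial>M) < (\<integral>\<^sup>+x. g x \<partial>M)"
      using eq fin by (intro nn_integral_less) (auto intro: le)
    then show False using eq by simp
  qed
  with AE_space show ?thesis
    by eventually_elim (auto intro: antisym le)
qed

context stationary_ergodic_flow
begin

lemma flow_space: "\<omega> \<in> space M \<Longrightarrow> \<theta> s \<omega> \<in> space M"
  using measurable_space[OF flow_measurable, of "(\<omega>, s)"] by (simp add: space_pair_measure)

lemma flow_measurable_at [measurable]: "\<theta> s \<in> M \<rightarrow>\<^sub>M M"
proof -
  have "(\<lambda>\<omega>. case (\<omega>, s) of (\<omega>, s) \<Rightarrow> \<theta> s \<omega>) \<in> M \<rightarrow>\<^sub>M M"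
    by (rule measurable_compose[OF _ flow_measurable]) simp
  then show ?thesis by simp
qed

lemma flow_inverse: "\<omega> \<in> space M \<Longrightarrow> \<theta> (- s) (\<theta> s \<omega>) = \<omega>" "\<omega> \<in> space M \<Longrightarrow> \<theta> s (\<theta> (- s) \<omega>) = \<omega>"
  by (simp_all add: flow_add flow_zero)

lemma flow_image: "A \<subseteq> space M \<Longrightarrow> \<theta> s ` A = \<theta> (- s) -` A \<inter> space M"
proof (intro antisym subsetI)
  fix \<omega> assume "A \<subseteq> space M" "\<omega> \<in> \<theta> (- s) -` A \<inter> space M"
  then show "\<omega> \<in> \<theta> s ` A"
    using flow_inverse(2)[of \<omega> s] by (intro image_eqI[of _ _ "\<theta> (- s) \<omega>"]) auto
next
  fix \<omega> assume "A \<subseteq> space M" "\<omega> \<in> \<theta> s ` A"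
  then show "\<omega> \<in> \<theta> (- s) -` A \<inter> space M"
    using flow_inverse(1) flow_space by auto
qed

lemma distr_flow: "distr M M (\<theta> s) = M"
proof (rule measure_eqI)
  fix A assume "A \<in> sets (distr M M (\<theta> s))"
  then have A: "A \<in> sets M" by simp
  then have "emeasure (distr M M (\<theta> s)) A = emeasure M (\<theta> (- s) ` A)"
    using flow_image[OF sets.sets_into_space[OF A], of "- s"] by (simp add: emeasure_distr)
  then show "emeasure (distr M M (\<theta> s)) A = emeasure M A"
    using stationary[OF A] by simp
qed simp

lemma nn_integral_flow:
  "h \<in> borel_measurable M \<Longrightarrow> (\<integral>\<^sup>+\<omega>. h (\<theta> s \<omega>) \<partial>M) = (\<integral>\<^sup>+\<omega>. h \<omega> \<partial>M)"
  using nn_integral_distr[OF flow_measurable_at, of h s] by (simp add: distr_flow)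

lemma AE_flow:
  assumes "AE \<omega> in M. P \<omega>"
  shows "AE \<omega> in M. P (\<theta> s \<omega>)"
proof (rule AE_distrD[OF flow_measurable_at])
  show "AE \<omega> in distr M M (\<theta> s). P \<omega>"
    unfolding distr_flow by fact
qed

lemma AE_flow_all_int: "AE \<omega> in M. P \<omega> \<Longrightarrow> AE \<omega> in M. \<forall>n::int. P (\<theta> (real_of_int n) \<omega>)"
  by (simp add: AE_all_countable AE_flow)

text \<open>Let \<open>N\<close> be a null set outside of which \<open>Q\<close> holds. The set \<open>G\<close> consists of the points whose orbit
  avoids \<open>N\<close> at almost every time. It is invariant since Lebesgue measure is translation invariant,
  and it has full measure by Fubini. Each orbit in \<open>G\<close> meets the complement of \<open>N\<close>, and from there \<open>Q\<close>
  spreads along the orbit.\<close>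

lemma invariant_conull_core:
  assumes AE: "AE \<omega> in M. Q \<omega>"
    and inv: "\<And>\<omega> t. \<omega> \<in> space M \<Longrightarrow> Q \<omega> \<Longrightarrow> Q (\<theta> t \<omega>)"
  obtains G where "G \<in> sets M" "AE \<omega> in M. \<omega> \<in> G" "\<And>\<omega>. \<omega> \<in> G \<Longrightarrow> Q \<omega>"
    "\<And>\<omega> t. \<omega> \<in> space M \<Longrightarrow> \<theta> t \<omega> \<in> G \<longleftrightarrow> \<omega> \<in> G"
proof -
  obtain N where N: "{\<omega>\<in>space M. \<not> Q \<omega>} \<subseteq> N" "N \<in> sets M" "emeasure M N = 0"
    using AE by (rule AE_E)
  define D where "D = (\<lambda>(\<omega>, s). \<theta> s \<omega>) -` N \<inter> space (M \<Otimes>\<^sub>M lborel)"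
  have D: "D \<in> sets (M \<Otimes>\<^sub>M lborel)"
    unfolding D_def using flow_measurable N(2) by (intro measurable_sets) (auto cong: measurable_cong_sets)
  have slice: "Pair \<omega> -` D = {t. \<theta> t \<omega> \<in> N}" if "\<omega> \<in> space M" for \<omega>
    using that by (auto simp: D_def space_pair_measure)
  have slice_borel: "{t. \<theta> t \<omega> \<in> N} \<in> sets lborel" if "\<omega> \<in> space M" for \<omega>
    using sets_Pair1[OF D, of \<omega>] slice[OF that] by simp
  define G where "G = {\<omega>\<in>space M. emeasure lborel (Pair \<omega> -` D) = 0}"
  have G: "G \<in> sets M"
    unfolding G_def using lborel.measurable_emeasure_Pair[OF D] by measurable
  have AE_iff: "\<omega> \<in> G \<longleftrightarrow> (AE t in lborel. \<theta> t \<omega> \<notin> N)" if "\<omega> \<in> space M" for \<omega>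
    using that slice_borel[OF that] by (simp add: G_def slice AE_iff_measurable[OF _ refl])
  have "AE \<omega> in M. \<theta> t \<omega> \<notin> N" for t
    by (rule AE_flow) (rule AE_not_in, use N in auto)
  then have "AE t in lborel. AE \<omega> in M. \<theta> t \<omega> \<notin> N" by simp
  moreover interpret P: pair_sigma_finite M lborel ..
  have "{x \<in> space (M \<Otimes>\<^sub>M lborel). \<theta> (snd x) (fst x) \<notin> N} = space (M \<Otimes>\<^sub>M lborel) - D"
    by (auto simp: D_def)
  then have "{x \<in> space (M \<Otimes>\<^sub>M lborel). \<theta> (snd x) (fst x) \<notin> N} \<in> sets (M \<Otimes>\<^sub>M lborel)"
    using sets.Diff[OF sets.top D] by (simp only:)
  ultimately have "AE \<omega> in M. AE t in lborel. \<theta> t \<omega> \<notin> N"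
    using P.AE_commute[of "\<lambda>\<omega> t. \<theta> t \<omega> \<notin> N"] by simp
  with AE_space have conull: "AE \<omega> in M. \<omega> \<in> G"
    by eventually_elim (simp add: AE_iff)
  have shift: "\<theta> u \<omega> \<in> G" if \<omega>: "\<omega> \<in> G" for \<omega> u
  proof -
    have space: "\<omega> \<in> space M" using \<omega> by (simp add: G_def)
    have "AE t in lborel. \<theta> t \<omega> \<notin> N" using \<omega> AE_iff[OF space] by simp
    then have "AE t in distr lborel borel ((+) u). \<theta> t \<omega> \<notin> N"
      by (simp only: lborel_distr_plus)
    then have "AE t in lborel. \<theta> (u + t) \<omega> \<notin> N"
      by (rule AE_distrD[rotated]) simp
    then have "AE t in lborel. \<theta> t (\<theta> u \<omega>) \<notin> N"
      by (simp add: flow_add[OF space] add.commute)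
    then show ?thesis using AE_iff[OF flow_space[OF space]] by simp
  qed
  have "\<theta> t \<omega> \<in> G \<longleftrightarrow> \<omega> \<in> G" if "\<omega> \<in> space M" for \<omega> t
    using shift[of "\<theta> t \<omega>" "- t"] shift[of \<omega> t] flow_inverse(1)[OF that] by auto
  moreover have "Q \<omega>" if \<omega>: "\<omega> \<in> G" for \<omega>
  proof -
    have space: "\<omega> \<in> space M" using \<omega> by (simp add: G_def)
    obtain t where "\<theta> t \<omega> \<notin> N"
    proof (rule ccontr)
      assume "\<not> thesis"
      then have "{t. \<theta> t \<omega> \<in> N} = UNIV" using that by auto
      then show False using \<omega> space by (simp add: G_def slice)
    qed
    then have "Q (\<theta> t \<omega>)" using N(1) flow_space[OF space] by auto
    then have "Q (\<theta> (- t) (\<theta> t \<omega>))" by (rule inv[OF flow_space[OF space]])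
    then show ?thesis by (simp add: flow_inverse space)
  qed
  ultimately show ?thesis using that[OF G conull] by blast
qed

lemma zero_one_law:
  assumes "A \<in> sets M" "\<And>\<omega> t. \<omega> \<in> A \<Longrightarrow> \<theta> t \<omega> \<in> A"
  shows "(AE \<omega> in M. \<omega> \<notin> A) \<or> (AE \<omega> in M. \<omega> \<in> A)"
proof -
  have "\<theta> s ` A = A" for s
  proof (intro antisym subsetI)
    fix \<omega> assume "\<omega> \<in> A"
    then show "\<omega> \<in> \<theta> s ` A"
      using flow_inverse(2)[of \<omega> s] sets.sets_into_space[OF assms(1)] assms(2)
      by (intro image_eqI[of _ _ "\<theta> (- s) \<omega>"]) auto
  qed (use assms(2) in auto)
  with ergodic[OF assms(1)] have "emeasure M A = 0 \<or> emeasure M (space M - A) = 0" by blast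
  then show ?thesis
  proof
    assume "emeasure M A = 0"
    then show ?thesis using assms(1) by (intro disjI1 AE_not_in null_setsI)
  next
    assume "emeasure M (space M - A) = 0"
    then have "AE \<omega> in M. \<omega> \<notin> space M - A" using assms(1) by (intro AE_not_in null_setsI) auto
    with AE_space have "AE \<omega> in M. \<omega> \<in> A" by eventually_elim auto
    then show ?thesis ..
  qed
qed

text \<open>As the translates of \<open>E\<close> by integer times are disjoint, the integral over \<open>E\<close> of the sum of \<open>h\<close>
  along the orbit unfolds to an integral of \<open>h\<close> over the union of these translates.\<close>

lemma wandering_orbit_sum_finite:
  fixes h :: "'w \<Rightarrow> ennreal"
  assumes E: "E \<in> sets M"
    and wandering: "\<And>\<omega> m n. \<omega> \<in> space M \<Longrightarrow> \<theta> (real_of_int m) \<omega> \<in> E \<Longrightarrow> \<theta> (real_of_int n) \<omega> \<in> E \<Longrightarrow> m = n"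
    and h: "h \<in> borel_measurable M" "(\<integral>\<^sup>+\<omega>. h \<omega> \<partial>M) < \<infinity>"
  shows "AE \<omega> in M. \<omega> \<in> E \<longrightarrow> (\<integral>\<^sup>+n. h (\<theta> (real_of_int n) \<omega>) \<partial>count_space UNIV) < \<infinity>"
proof -
  note [measurable] = E h(1)
  have "(\<integral>\<^sup>+\<omega>. (\<integral>\<^sup>+n. indicator E \<omega> * h (\<theta> (real_of_int n) \<omega>) \<partial>count_space UNIV) \<partial>M)
      = (\<integral>\<^sup>+n. (\<integral>\<^sup>+\<omega>. indicator E \<omega> * h (\<theta> (real_of_int n) \<omega>) \<partial>M) \<partial>count_space UNIV)"
    by (rule nn_integral_count_space_nn_integral) auto
  also have "\<dots> = (\<integral>\<^sup>+n. (\<integral>\<^sup>+\<omega>. indicator E (\<theta> (- real_of_int n) \<omega>) * h \<omega> \<partial>M) \<partial>count_space UNIV)"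
  proof (rule nn_integral_cong)
    fix n :: int
    have "(\<integral>\<^sup>+\<omega>. indicator E (\<theta> (- real_of_int n) \<omega>) * h (\<theta> (real_of_int n) (\<theta> (- real_of_int n) \<omega>)) \<partial>M)
        = (\<integral>\<^sup>+\<omega>. indicator E \<omega> * h (\<theta> (real_of_int n) \<omega>) \<partial>M)"
      by (rule nn_integral_flow) measurable
    then show "(\<integral>\<^sup>+\<omega>. indicator E \<omega> * h (\<theta> (real_of_int n) \<omega>) \<partial>M)
        = (\<integral>\<^sup>+\<omega>. indicator E (\<theta> (- real_of_int n) \<omega>) * h \<omega> \<partial>M)"
      by (simp add: flow_inverse cong: nn_integral_cong_simp)
  qed
  also have "\<dots> = (\<integral>\<^sup>+\<omega>. (\<integral>\<^sup>+n. indicator E (\<theta> (- real_of_int n) \<omega>) * h \<omega> \<partial>count_space UNIV) \<partial>M)"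
    by (rule nn_integral_count_space_nn_integral[symmetric]) auto
  also have "\<dots> \<le> (\<integral>\<^sup>+\<omega>. h \<omega> \<partial>M)"
  proof (rule nn_integral_mono)
    fix \<omega> assume \<omega>: "\<omega> \<in> space M"
    have "(\<integral>\<^sup>+n. indicator E (\<theta> (- real_of_int n) \<omega>) * h \<omega> \<partial>count_space UNIV) \<le> h \<omega>"
    proof (cases "\<exists>n::int. \<theta> (- real_of_int n) \<omega> \<in> E")
      case True
      then obtain n :: int where n: "\<theta> (- real_of_int n) \<omega> \<in> E" by blast
      have "\<theta> (- real_of_int m) \<omega> \<in> E \<longleftrightarrow> m = n" for m :: int
        using wandering[OF \<omega>, of "- m" "- n"] n by auto
      then have "indicator E (\<theta> (- real_of_int m) \<omega>) = (indicator {n} m :: ennreal)" for m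
        by (simp only: indicator_def singleton_iff)
      then have "(\<integral>\<^sup>+n. indicator E (\<theta> (- real_of_int n) \<omega>) * h \<omega> \<partial>count_space UNIV)
          = (\<integral>\<^sup>+m. h \<omega> * indicator {n} m \<partial>count_space UNIV)"
        by (simp only: mult.commute)
      also have "\<dots> = h \<omega>"
        by (subst nn_integral_cmult_indicator) auto
      finally show ?thesis by simp
    next
      case False
      then show ?thesis by simp
    qed
    then show "(\<integral>\<^sup>+n. indicator E (\<theta> (- real_of_int n) \<omega>) * h \<omega> \<partial>count_space UNIV) \<le> h \<omega>" .
  qed
  also have "\<dots> < \<infinity>" by fact
  finally have "AE \<omega> in M. (\<integral>\<^sup>+n. indicator E \<omega> * h (\<theta> (real_of_int n) \<omega>) \<partial>count_space UNIV) \<noteq> \<infinity>"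
    by (intro nn_integral_PInf_AE borel_measurable_int_sum) auto
  then show ?thesis
    by eventually_elim (auto simp: less_top)
qed

end

section \<open>Mass transport for invariant measures\<close>

lemma unit_Ioc_iff: "x \<in> {real_of_int i<..real_of_int i + 1} \<longleftrightarrow> i = \<lceil>x\<rceil> - 1"
proof -
  have "x \<in> {real_of_int i<..real_of_int i + 1} \<longleftrightarrow> \<lceil>x\<rceil> = i + 1"
    by (simp add: ceiling_eq_iff)
  then show ?thesis by auto
qed

text \<open>Real bounds suffice because they are dense in the extended reals.\<close>

lemma ereal_eqI_less:
  fixes x z :: ereal
  assumes "\<And>y::real. x < ereal y \<longleftrightarrow> z < ereal y"
  shows "x = z"
  using assms ereal_dense2 by (metis less_asym linorder_less_linear)

lemma ereal_minus_less_real: "(x::ereal) - ereal t < ereal y \<longleftrightarrow> x < ereal (y + t)"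
  by (cases x) auto

lemma shift_Ioc_ereal: "{x. x - ereal t \<in> {ereal a<..ereal b}} = {ereal (a + t)<..ereal (b + t)}"
proof (rule set_eqI)
  fix x :: ereal
  show "x \<in> {x. x - ereal t \<in> {ereal a<..ereal b}} \<longleftrightarrow> x \<in> {ereal (a + t)<..ereal (b + t)}"
    by (cases x) auto
qed

lemma match_time_translate:
  assumes "\<And>a b. emeasure \<mu>' {a..b} = emeasure \<mu> {a + t..b + t}"
    and "\<And>a b. emeasure \<nu>' {a..b} = emeasure \<nu> {a + t..b + t}"
  shows "match_time \<mu>' \<nu>' s = match_time \<mu> \<nu> (s + t) - ereal t"
proof (rule ereal_eqI_less)
  fix y :: real
  have "(\<exists>u. s < u \<and> u < y \<and> emeasure \<mu> {s + t..u + t} \<le> emeasure \<nu> {s + t..u + t}) \<longleftrightarrow>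
    (\<exists>v. s + t < v \<and> v < y + t \<and> emeasure \<mu> {s + t..v} \<le> emeasure \<nu> {s + t..v})" (is "?l \<longleftrightarrow> ?r")
  proof
    assume ?l
    then obtain u where "s < u" "u < y" "emeasure \<mu> {s + t..u + t} \<le> emeasure \<nu> {s + t..u + t}" by blast
    then show ?r by (intro exI[of _ "u + t"]) simp
  next
    assume ?r
    then obtain v where "s + t < v" "v < y + t" "emeasure \<mu> {s + t..v} \<le> emeasure \<nu> {s + t..v}" by blast
    then show ?l by (intro exI[of _ "v - t"]) simp
  qed
  then show "match_time \<mu>' \<nu>' s < ereal y \<longleftrightarrow> match_time \<mu> \<nu> (s + t) - ereal t < ereal y"
    unfolding ereal_minus_less_real match_time_less_iff assms .
qed

text \<open>Equality on unit cells gives equality on a large interval \<open>{- N<..N}\<close>. As the image is at most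
  \<open>\<nu>\<close> on each of the pieces \<open>{- N<..a}\<close>, \<open>{a<..b}\<close> and \<open>{b<..N}\<close>, a deficit on one of them could not
  be compensated.\<close>

lemma (in radon_singular_pair) matched_mass_eq_of_units:
  assumes units: "\<And>n::int. emeasure \<mu> {s. ereal (real_of_int n) < match_time \<mu> \<nu> s \<and> match_time \<mu> \<nu> s \<le> ereal (real_of_int n + 1)}
      = emeasure \<nu> {real_of_int n<..real_of_int n + 1}"
    and "a < b"
  shows "emeasure \<mu> {s. ereal a < match_time \<mu> \<nu> s \<and> match_time \<mu> \<nu> s \<le> ereal b} = emeasure \<nu> {a<..b}"
proof -
  define X where "X a b = {s. ereal a < match_time \<mu> \<nu> s \<and> match_time \<mu> \<nu> s \<le> ereal b}" for a b
  have X_sets: "X a b \<in> sets \<mu>" for a b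
    unfolding X_def radon_sets[OF \<mu>] by (rule matched_borel)
  have X_le: "emeasure \<mu> (X a b) \<le> emeasure \<nu> {a<..b}" if "a < b" for a b
    unfolding X_def by (rule matched_mass_le[OF that])
  obtain N where "\<bar>a\<bar> + \<bar>b\<bar> < real N" using reals_Archimedean2 by blast
  then have N: "- real N < a" "b < real N" using \<open>a < b\<close> by auto
  define I where "I = {- int N..<int N}"
  have unit_ereal: "s \<in> X (real_of_int n) (real_of_int n + 1) \<longleftrightarrow>
      (\<exists>x. match_time \<mu> \<nu> s = ereal x \<and> n = \<lceil>x\<rceil> - 1)" for n s
    using unit_Ioc_iff[of _ n] by (cases "match_time \<mu> \<nu> s") (auto simp: X_def)
  have "emeasure \<mu> (X (- real N) (real N)) = (\<integral>\<^sup>+n. emeasure \<mu> (X (real_of_int n) (real_of_int n + 1)) \<partial>count_space I)"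
  proof -
    have "X (- real N) (real N) = (\<Union>n\<in>I. X (real_of_int n) (real_of_int n + 1))"
    proof (intro set_eqI iffI)
      fix s assume s: "s \<in> X (- real N) (real N)"
      then obtain x where x: "match_time \<mu> \<nu> s = ereal x"
        by (cases "match_time \<mu> \<nu> s") (auto simp: X_def)
      then have "- real N < x" "x \<le> real N" using s by (auto simp: X_def)
      then have "- int N < \<lceil>x\<rceil>" "\<lceil>x\<rceil> \<le> int N"
        by (simp_all add: less_ceiling_iff ceiling_le_iff)
      then have "\<lceil>x\<rceil> - 1 \<in> I" by (simp add: I_def)
      then show "s \<in> (\<Union>n\<in>I. X (real_of_int n) (real_of_int n + 1))"
        using x by (auto simp: unit_ereal)
    next
      fix s assume "s \<in> (\<Union>n\<in>I. X (real_of_int n) (real_of_int n + 1))"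
      then obtain n where n: "n \<in> I" "s \<in> X (real_of_int n) (real_of_int n + 1)" by blast
      have "- int N \<le> n" "n + 1 \<le> int N" using n(1) by (auto simp: I_def)
      then have "- real N \<le> real_of_int n" "real_of_int n + 1 \<le> real N" by linarith+
      then show "s \<in> X (- real N) (real N)"
        using n(2) by (cases "match_time \<mu> \<nu> s") (auto simp: X_def)
    qed
    then show ?thesis
      by (simp only:) (rule emeasure_UN_countable, auto simp: X_sets disjoint_family_on_def unit_ereal)
  qed
  also have "\<dots> = (\<integral>\<^sup>+n. emeasure \<nu> {real_of_int n<..real_of_int n + 1} \<partial>count_space I)"
    using units by (simp add: X_def)
  also have "\<dots> = emeasure \<nu> {- real N<..real N}"
  proof -
    have "{- real N<..real N} = (\<Union>n\<in>I. {real_of_int n<..real_of_int n + 1})"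
    proof (intro set_eqI iffI)
      fix x assume x: "x \<in> {- real N<..real N}"
      then have "- int N < \<lceil>x\<rceil>" "\<lceil>x\<rceil> \<le> int N"
        by (simp_all add: less_ceiling_iff ceiling_le_iff)
      then have "\<lceil>x\<rceil> - 1 \<in> I" by (simp add: I_def)
      then show "x \<in> (\<Union>n\<in>I. {real_of_int n<..real_of_int n + 1})"
        using unit_Ioc_iff[of x] by blast
    next
      fix x assume "x \<in> (\<Union>n\<in>I. {real_of_int n<..real_of_int n + 1})"
      then obtain n where n: "n \<in> I" "x \<in> {real_of_int n<..real_of_int n + 1}" by blast
      have "- int N \<le> n" "n + 1 \<le> int N" using n(1) by (auto simp: I_def)
      then have "- real N \<le> real_of_int n" "real_of_int n + 1 \<le> real N" by linarith+
      then show "x \<in> {- real N<..real N}" using n(2) by auto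
    qed
    then show ?thesis
      by (simp only:) (rule emeasure_UN_countable[symmetric],
          auto simp: radon_sets[OF \<nu>] disjoint_family_on_def unit_Ioc_iff simp del: greaterThanAtMost_iff)
  qed
  finally have total: "emeasure \<mu> (X (- real N) (real N)) = emeasure \<nu> {- real N<..real N}" .
  have X_split: "emeasure \<mu> (X c e) = emeasure \<mu> (X c d) + emeasure \<mu> (X d e)" if "c \<le> d" "d \<le> e" for c d e
  proof -
    have "X c e = X c d \<union> X d e"
    proof (rule set_eqI)
      fix s show "s \<in> X c e \<longleftrightarrow> s \<in> X c d \<union> X d e"
        using that by (cases "match_time \<mu> \<nu> s") (auto simp: X_def)
    qed
    moreover have "X c d \<inter> X d e = {}" by (auto simp: X_def)
    ultimately show ?thesis by (simp add: plus_emeasure X_sets)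
  qed
  have \<nu>_split: "emeasure \<nu> {c<..e} = emeasure \<nu> {c<..d} + emeasure \<nu> {d<..e}" if "c \<le> d" "d \<le> e" for c d e
  proof -
    have "{c<..e} = {c<..d} \<union> {d<..e}" using that by auto
    moreover have "{c<..d} \<inter> {d<..e} = {}" by auto
    ultimately show ?thesis by (simp add: plus_emeasure radon_sets[OF \<nu>])
  qed
  have finite: "emeasure \<nu> {c<..d} < \<infinity>" for c d
    by (rule radon_finite[OF \<nu>, of _ c d]) auto
  show ?thesis
  proof (rule ccontr)
    assume "\<not> ?thesis"
    then have less: "emeasure \<mu> (X a b) < emeasure \<nu> {a<..b}"
      using X_le[OF \<open>a < b\<close>] by (simp add: X_def)
    have "emeasure \<mu> (X (- real N) (real N)) = (emeasure \<mu> (X (- real N) a) + emeasure \<mu> (X b (real N))) + emeasure \<mu> (X a b)"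
      using N \<open>a < b\<close> by (simp add: X_split[of "- real N" a "real N"] X_split[of a b "real N"] ac_simps)
    also have "\<dots> \<le> (emeasure \<nu> {- real N<..a} + emeasure \<nu> {b<..real N}) + emeasure \<mu> (X a b)"
      using N by (intro add_mono X_le order_refl)
    also have "\<dots> < (emeasure \<nu> {- real N<..a} + emeasure \<nu> {b<..real N}) + emeasure \<nu> {a<..b}"
      using less finite by (intro ennreal_add_left_cancel_less[THEN iffD2]) (auto simp: less_top)
    also have "\<dots> = emeasure \<nu> {- real N<..real N}"
      using N \<open>a < b\<close> by (simp add: \<nu>_split[of "- real N" a "real N"] \<nu>_split[of a b "real N"] ac_simps)
    finally show False using total by simp
  qed
qed

text \<open>A stationary measure has no atoms at fixed times in the mean: all points have the same mean mass
  \<open>c\<close>, and the infinitely many points \<open>1 / (k + 1)\<close> lie in \<open>{0..1}\<close>, which has finite mean mass.\<close>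

lemma (in stationary_ergodic_flow) intensity_half_open:
  assumes sets: "\<And>\<omega>. \<omega> \<in> space M \<Longrightarrow> sets (\<kappa> \<omega>) = sets borel"
    and meas: "\<And>C. C \<in> sets borel \<Longrightarrow> (\<lambda>\<omega>. emeasure (\<kappa> \<omega>) C) \<in> borel_measurable M"
    and shift: "\<And>\<omega> t C. \<omega> \<in> space M \<Longrightarrow> C \<in> sets borel \<Longrightarrow>
      emeasure (\<kappa> (\<theta> t \<omega>)) C = emeasure (\<kappa> \<omega>) {x. x - t \<in> C}"
    and finite: "intensity M \<kappa> < \<infinity>"
  shows "(\<integral>\<^sup>+\<omega>. emeasure (\<kappa> \<omega>) {0<..1} \<partial>M) = intensity M \<kappa>"
proof -
  define c where "c = (\<integral>\<^sup>+\<omega>. emeasure (\<kappa> \<omega>) {0} \<partial>M)"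
  define p where "p k = 1 / real (Suc k)" for k
  have point: "(\<integral>\<^sup>+\<omega>. emeasure (\<kappa> \<omega>) {t} \<partial>M) = c" for t
  proof -
    have "{x. x - t \<in> {0}} = {t}" by auto
    then have "(\<integral>\<^sup>+\<omega>. emeasure (\<kappa> \<omega>) {t} \<partial>M) = (\<integral>\<^sup>+\<omega>. emeasure (\<kappa> (\<theta> t \<omega>)) {0} \<partial>M)"
      by (intro nn_integral_cong) (simp add: shift)
    also have "\<dots> = c" unfolding c_def by (rule nn_integral_flow) (simp add: meas)
    finally show ?thesis .
  qed
  have "c * \<infinity> = (\<integral>\<^sup>+(k::nat). c \<partial>count_space UNIV)"
    by (simp add: nn_integral_const)
  also have "\<dots> = (\<integral>\<^sup>+k. (\<integral>\<^sup>+\<omega>. emeasure (\<kappa> \<omega>) {p k} \<partial>M) \<partial>count_space UNIV)"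
    by (simp add: point)
  also have "\<dots> = (\<integral>\<^sup>+\<omega>. (\<integral>\<^sup>+k. emeasure (\<kappa> \<omega>) {p k} \<partial>count_space UNIV) \<partial>M)"
    by (rule nn_integral_count_space_nn_integral[symmetric]) (auto simp: meas)
  also have "\<dots> \<le> (\<integral>\<^sup>+\<omega>. emeasure (\<kappa> \<omega>) {0..1} \<partial>M)"
  proof (rule nn_integral_mono)
    fix \<omega> assume \<omega>: "\<omega> \<in> space M"
    have "(\<integral>\<^sup>+k. emeasure (\<kappa> \<omega>) {p k} \<partial>count_space UNIV) = emeasure (\<kappa> \<omega>) (\<Union>k. {p k})"
      by (rule emeasure_UN_countable[symmetric]) (auto simp: sets[OF \<omega>] disjoint_family_on_def p_def)
    also have "\<dots> \<le> emeasure (\<kappa> \<omega>) {0..1}"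
      by (intro emeasure_mono) (auto simp: sets[OF \<omega>] p_def)
    finally show "(\<integral>\<^sup>+k. emeasure (\<kappa> \<omega>) {p k} \<partial>count_space UNIV) \<le> emeasure (\<kappa> \<omega>) {0..1}" .
  qed
  also have "\<dots> < \<infinity>" using finite by (simp add: intensity_def)
  finally have "c = 0" by (auto simp: ennreal_mult_top split: if_splits)
  have "intensity M \<kappa> = (\<integral>\<^sup>+\<omega>. emeasure (\<kappa> \<omega>) {0} + emeasure (\<kappa> \<omega>) {0<..1} \<partial>M)"
    unfolding intensity_def
  proof (rule nn_integral_cong)
    fix \<omega> assume \<omega>: "\<omega> \<in> space M"
    have "{0..1::real} = {0} \<union> {0<..1}" by auto
    then show "emeasure (\<kappa> \<omega>) {0..1} = emeasure (\<kappa> \<omega>) {0} + emeasure (\<kappa> \<omega>) {0<..1}"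
      by (simp only:) (rule plus_emeasure[symmetric], auto simp: sets[OF \<omega>])
  qed
  also have "\<dots> = c + (\<integral>\<^sup>+\<omega>. emeasure (\<kappa> \<omega>) {0<..1} \<partial>M)"
    unfolding c_def by (rule nn_integral_add) (simp_all add: meas)
  finally show ?thesis using \<open>c = 0\<close> by simp
qed

locale matched_flow = stationary_ergodic_flow M \<theta>
  for M :: "'w measure" and \<theta> :: "real \<Rightarrow> 'w \<Rightarrow> 'w" +
  fixes \<xi> \<eta> :: "'w \<Rightarrow> real measure"
  assumes regular: "\<And>\<omega>. \<omega> \<in> space M \<Longrightarrow> radon_singular_pair (\<xi> \<omega>) (\<eta> \<omega>)"
    and \<xi>_measurable: "\<And>C. C \<in> sets borel \<Longrightarrow> (\<lambda>\<omega>. emeasure (\<xi> \<omega>) C) \<in> borel_measurable M"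
    and \<eta>_measurable: "\<And>C. C \<in> sets borel \<Longrightarrow> (\<lambda>\<omega>. emeasure (\<eta> \<omega>) C) \<in> borel_measurable M"
    and \<xi>_shift: "\<And>\<omega> t C. \<omega> \<in> space M \<Longrightarrow> C \<in> sets borel \<Longrightarrow>
      emeasure (\<xi> (\<theta> t \<omega>)) C = emeasure (\<xi> \<omega>) {x. x - t \<in> C}"
    and \<eta>_shift: "\<And>\<omega> t C. \<omega> \<in> space M \<Longrightarrow> C \<in> sets borel \<Longrightarrow>
      emeasure (\<eta> (\<theta> t \<omega>)) C = emeasure (\<eta> \<omega>) {x. x - t \<in> C}"
begin

definition \<tau> :: "'w \<Rightarrow> real \<Rightarrow> ereal" where
  "\<tau> \<omega> = match_time (\<xi> \<omega>) (\<eta> \<omega>)"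

lemma \<xi>_radon: "\<omega> \<in> space M \<Longrightarrow> radon (\<xi> \<omega>)"
  using regular by (rule radon_singular_pair.\<mu>)

lemma \<eta>_radon: "\<omega> \<in> space M \<Longrightarrow> radon (\<eta> \<omega>)"
  using regular by (rule radon_singular_pair.\<nu>)

lemma \<tau>_not_minus_infinity: "\<tau> \<omega> s \<noteq> -\<infinity>"
  using match_time_ge[of s "\<xi> \<omega>" "\<eta> \<omega>"] by (auto simp: \<tau>_def)

lemma \<tau>_borel: "\<omega> \<in> space M \<Longrightarrow> \<tau> \<omega> \<in> borel_measurable borel"
  unfolding \<tau>_def using regular by (rule radon_singular_pair.match_time_borel)

lemma \<tau>_measurable: "(\<lambda>(\<omega>, s). \<tau> \<omega> s) \<in> borel_measurable (M \<Otimes>\<^sub>M borel)"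
proof -
  have "(\<lambda>(\<omega>, s). \<tau> \<omega> s) x = (\<lambda>(\<omega>, s). rational_match_time (\<xi> \<omega>) (\<eta> \<omega>) s) x"
    if "x \<in> space (M \<Otimes>\<^sub>M borel)" for x
    using that \<xi>_radon \<eta>_radon regular[THEN radon_singular_pair.atomless]
    by (auto simp: space_pair_measure \<tau>_def rational_match_time_eq)
  note eq = this
  show ?thesis
    by (subst measurable_cong[OF eq], assumption) (rule rational_match_time_measurable[OF \<xi>_measurable \<eta>_measurable])
qed

lemma \<tau>_shift: "\<omega> \<in> space M \<Longrightarrow> \<tau> (\<theta> t \<omega>) s = \<tau> \<omega> (s + t) - ereal t"
proof -
  assume \<omega>: "\<omega> \<in> space M"
  have "{x. x - t \<in> {a..b}} = {a + t..b + t}" for a b by auto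
  then show ?thesis
    unfolding \<tau>_def using \<xi>_shift[OF \<omega>, of "{_.._}" t] \<eta>_shift[OF \<omega>, of "{_.._}" t]
    by (intro match_time_translate) simp_all
qed

text \<open>The mass of \<open>\<xi>\<close> that is transported from \<open>A\<close> to \<open>B\<close>; taking \<open>B = {\<infinity>}\<close> gives the unmatched mass
  in \<open>A\<close>.\<close>

definition flux :: "'w \<Rightarrow> real set \<Rightarrow> ereal set \<Rightarrow> ennreal" where
  "flux \<omega> A B = emeasure (\<xi> \<omega>) {s\<in>A. \<tau> \<omega> s \<in> B}"

lemma flux_sets:
  assumes "\<omega> \<in> space M" "A \<in> sets borel" "B \<in> sets borel"
  shows "{s\<in>A. \<tau> \<omega> s \<in> B} \<in> sets (\<xi> \<omega>)"
proof -
  note [measurable] = assms(2,3) \<tau>_borel[OF assms(1)]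
  show ?thesis unfolding radon_sets[OF \<xi>_radon[OF assms(1)]] by measurable
qed

lemma flux_measurable:
  assumes [measurable]: "A \<in> sets borel" "B \<in> sets borel"
  shows "(\<lambda>\<omega>. flux \<omega> A B) \<in> borel_measurable M"
proof -
  note [measurable] = \<tau>_measurable
  define D where "D = {x\<in>space (M \<Otimes>\<^sub>M borel). snd x \<in> A \<and> (\<lambda>(\<omega>, s). \<tau> \<omega> s) x \<in> B}"
  have D: "D \<in> sets (M \<Otimes>\<^sub>M borel)" unfolding D_def by measurable
  have eq: "flux \<omega> A B = emeasure (\<xi> \<omega>) (Pair \<omega> -` D)" if "\<omega> \<in> space M" for \<omega>
    using that by (simp add: flux_def D_def space_pair_measure vimage_def)
  show ?thesis
    by (subst measurable_cong[OF eq], assumption) (rule kernel_section_measurable[OF \<xi>_radon \<xi>_measurable D])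
qed

lemma flux_shift:
  assumes "\<omega> \<in> space M" "A \<in> sets borel" "B \<in> sets borel"
  shows "flux (\<theta> t \<omega>) A B = flux \<omega> {s. s - t \<in> A} {x. x - ereal t \<in> B}"
proof -
  have "{s\<in>A. \<tau> (\<theta> t \<omega>) s \<in> B} \<in> sets borel"
    using flux_sets[OF flow_space[OF assms(1)] assms(2,3)] radon_sets[OF \<xi>_radon[OF flow_space[OF assms(1)]]]
    by simp
  then show ?thesis
    unfolding flux_def by (subst \<xi>_shift[OF assms(1)]) (simp_all add: \<tau>_shift[OF assms(1)])
qed

lemma flux_UNIV_le: "\<omega> \<in> space M \<Longrightarrow> a < b \<Longrightarrow> flux \<omega> UNIV {ereal a<..ereal b} \<le> emeasure (\<eta> \<omega>) {a<..b}"
  using radon_singular_pair.matched_mass_le[OF regular] by (simp add: flux_def \<tau>_def)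

lemma flux_le: "\<omega> \<in> space M \<Longrightarrow> A \<in> sets borel \<Longrightarrow> flux \<omega> A B \<le> emeasure (\<xi> \<omega>) A"
  unfolding flux_def by (intro emeasure_mono) (auto simp: radon_sets[OF \<xi>_radon])

text \<open>The mean mass received by \<open>{0<..1}\<close> is the sum over \<open>i\<close> of the mean mass sent from cell \<open>i\<close> to
  cell \<open>0\<close>. By stationarity, this is the sum of the mean masses sent from cell \<open>0\<close> to cell \<open>- i\<close>, that
  is, the mean mass of cell \<open>0\<close> that is sent to a finite time.\<close>

lemma mass_transport:
  "(\<integral>\<^sup>+\<omega>. flux \<omega> UNIV {ereal 0<..ereal 1} \<partial>M) = (\<integral>\<^sup>+\<omega>. flux \<omega> {0<..1} (- {\<infinity>}) \<partial>M)"
proof -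
  let ?R = "\<lambda>i::int. {real_of_int i<..real_of_int i + 1}"
  let ?E = "\<lambda>i::int. {ereal (real_of_int i)<..ereal (real_of_int i + 1)}"
  have unit_ereal: "x \<in> ?E i \<longleftrightarrow> (\<exists>r. x = ereal r \<and> i = \<lceil>r\<rceil> - 1)" for x i
    using unit_Ioc_iff[of _ i] by (cases x) auto
  have "(\<integral>\<^sup>+\<omega>. flux \<omega> UNIV {ereal 0<..ereal 1} \<partial>M) = (\<integral>\<^sup>+\<omega>. (\<integral>\<^sup>+i. flux \<omega> (?R i) (?E 0) \<partial>count_space UNIV) \<partial>M)"
  proof (rule nn_integral_cong)
    fix \<omega> assume \<omega>: "\<omega> \<in> space M"
    have "{s\<in>UNIV. \<tau> \<omega> s \<in> {ereal 0<..ereal 1}} = (\<Union>i. {s\<in>?R i. \<tau> \<omega> s \<in> ?E 0})"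
      using unit_Ioc_iff by (auto simp del: greaterThanAtMost_iff)
    moreover have "disjoint_family (\<lambda>i. {s\<in>?R i. \<tau> \<omega> s \<in> ?E 0})"
      by (auto simp: disjoint_family_on_def unit_Ioc_iff simp del: greaterThanAtMost_iff)
    ultimately show "flux \<omega> UNIV {ereal 0<..ereal 1} = (\<integral>\<^sup>+i. flux \<omega> (?R i) (?E 0) \<partial>count_space UNIV)"
      unfolding flux_def
      by (simp only:)
        (rule emeasure_UN_countable[OF flux_sets[OF \<omega> greaterThanAtMost_borel greaterThanAtMost_borel]], simp_all)
  qed
  also have "\<dots> = (\<integral>\<^sup>+i. (\<integral>\<^sup>+\<omega>. flux \<omega> (?R i) (?E 0) \<partial>M) \<partial>count_space UNIV)"
    by (rule nn_integral_count_space_nn_integral) (auto intro!: flux_measurable)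
  also have "\<dots> = (\<integral>\<^sup>+i. (\<integral>\<^sup>+\<omega>. flux \<omega> (?R 0) (?E (- i)) \<partial>M) \<partial>count_space UNIV)"
  proof (rule nn_integral_cong)
    fix i :: int
    have "(\<integral>\<^sup>+\<omega>. flux \<omega> (?R i) (?E 0) \<partial>M) = (\<integral>\<^sup>+\<omega>. flux (\<theta> (- real_of_int i) \<omega>) (?R i) (?E 0) \<partial>M)"
      by (rule nn_integral_flow[symmetric]) (auto intro!: flux_measurable)
    also have "\<dots> = (\<integral>\<^sup>+\<omega>. flux \<omega> (?R 0) (?E (- i)) \<partial>M)"
    proof (rule nn_integral_cong)
      fix \<omega> assume \<omega>: "\<omega> \<in> space M"
      have "{s. s - (- real_of_int i) \<in> ?R i} = ?R 0" by auto
      moreover have "{x. x - ereal (- real_of_int i) \<in> ?E 0} = ?E (- i)"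
        unfolding shift_Ioc_ereal by simp
      ultimately show "flux (\<theta> (- real_of_int i) \<omega>) (?R i) (?E 0) = flux \<omega> (?R 0) (?E (- i))"
        by (simp only: flux_shift[OF \<omega> greaterThanAtMost_borel greaterThanAtMost_borel])
    qed
    finally show "(\<integral>\<^sup>+\<omega>. flux \<omega> (?R i) (?E 0) \<partial>M) = (\<integral>\<^sup>+\<omega>. flux \<omega> (?R 0) (?E (- i)) \<partial>M)" .
  qed
  also have "\<dots> = (\<integral>\<^sup>+i. (\<integral>\<^sup>+\<omega>. flux \<omega> (?R 0) (?E i) \<partial>M) \<partial>count_space UNIV)"
    by (rule nn_integral_bij_count_space) (rule bij_uminus)
  also have "\<dots> = (\<integral>\<^sup>+\<omega>. (\<integral>\<^sup>+i. flux \<omega> (?R 0) (?E i) \<partial>count_space UNIV) \<partial>M)"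
    by (rule nn_integral_count_space_nn_integral[symmetric]) (auto intro!: flux_measurable)
  also have "\<dots> = (\<integral>\<^sup>+\<omega>. flux \<omega> {0<..1} (- {\<infinity>}) \<partial>M)"
  proof (rule nn_integral_cong)
    fix \<omega> assume \<omega>: "\<omega> \<in> space M"
    have "{s\<in>?R 0. \<tau> \<omega> s \<in> - {\<infinity>}} = (\<Union>i. {s\<in>?R 0. \<tau> \<omega> s \<in> ?E i})"
    proof (intro set_eqI iffI)
      fix s assume s: "s \<in> {s\<in>?R 0. \<tau> \<omega> s \<in> - {\<infinity>}}"
      then obtain r where "\<tau> \<omega> s = ereal r"
        using \<tau>_not_minus_infinity[of \<omega> s] by (cases "\<tau> \<omega> s") auto
      then show "s \<in> (\<Union>i. {s\<in>?R 0. \<tau> \<omega> s \<in> ?E i})"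
        using s by (auto simp: unit_ereal simp del: greaterThanAtMost_iff)
    qed auto
    then have "flux \<omega> (?R 0) (- {\<infinity>}) = emeasure (\<xi> \<omega>) (\<Union>i. {s\<in>?R 0. \<tau> \<omega> s \<in> ?E i})"
      unfolding flux_def by (rule arg_cong)
    also have "\<dots> = (\<integral>\<^sup>+i. flux \<omega> (?R 0) (?E i) \<partial>count_space UNIV)"
      unfolding flux_def
    proof (rule emeasure_UN_countable[OF flux_sets[OF \<omega> greaterThanAtMost_borel greaterThanAtMost_borel]])
      show "disjoint_family (\<lambda>i. {s\<in>?R 0. \<tau> \<omega> s \<in> ?E i})"
        by (auto simp: disjoint_family_on_def unit_ereal simp del: greaterThanAtMost_iff)
    qed simp
    finally show "(\<integral>\<^sup>+i. flux \<omega> (?R 0) (?E i) \<partial>count_space UNIV) = flux \<omega> {0<..1} (- {\<infinity>})"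
      by simp
  qed
  finally show ?thesis .
qed

end

section \<open>Balance of invariant measures of equal intensity\<close>

lemma shift_infinity_ereal: "{x. x - ereal t \<in> {\<infinity>}} = {\<infinity>}"
proof (rule set_eqI)
  fix x :: ereal show "x \<in> {x. x - ereal t \<in> {\<infinity>}} \<longleftrightarrow> x \<in> {\<infinity>}" by (cases x) auto
qed

lemma ereal_image_Ioc: "ereal ` {a<..b} = {ereal a<..ereal b}"
proof (rule set_eqI)
  fix x show "x \<in> ereal ` {a<..b} \<longleftrightarrow> x \<in> {ereal a<..ereal b}" by (cases x) auto
qed

lemma ereal_image_borel:
  assumes "C \<in> sets borel"
  shows "ereal ` C \<in> sets borel"
proof -
  have "(real_of_ereal :: ereal \<Rightarrow> real) \<in> borel_measurable borel" by measurable
  then have "(real_of_ereal :: ereal \<Rightarrow> real) -` C \<inter> space borel \<in> sets borel"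
    using assms by (rule measurable_sets)
  then have "((real_of_ereal :: ereal \<Rightarrow> real) -` C \<inter> space borel) - {\<infinity>, -\<infinity>} \<in> sets borel" by auto
  also have "((real_of_ereal :: ereal \<Rightarrow> real) -` C \<inter> space borel) - {\<infinity>, -\<infinity>} = ereal ` C"
  proof (rule set_eqI)
    fix x show "x \<in> (real_of_ereal -` C \<inter> space borel) - {\<infinity>, -\<infinity>} \<longleftrightarrow> x \<in> ereal ` C"
      by (cases x) auto
  qed
  finally show ?thesis .
qed

locale balanced_flow = matched_flow M \<theta> \<xi> \<eta>
  for M :: "'w measure" and \<theta> :: "real \<Rightarrow> 'w \<Rightarrow> 'w" and \<xi> \<eta> :: "'w \<Rightarrow> real measure" +
  assumes finite_intensity: "intensity M \<xi> < \<infinity>"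
    and equal_intensity: "intensity M \<xi> = intensity M \<eta>"
    and mass: "finite_measure M \<or> zero_or_infinite_mass M \<xi>"
begin

lemma \<xi>_intensity: "(\<integral>\<^sup>+\<omega>. emeasure (\<xi> \<omega>) {0<..1} \<partial>M) = intensity M \<xi>"
  by (rule intensity_half_open[OF radon_sets[OF \<xi>_radon] \<xi>_measurable \<xi>_shift finite_intensity])

lemma \<eta>_intensity: "(\<integral>\<^sup>+\<omega>. emeasure (\<eta> \<omega>) {0<..1} \<partial>M) = intensity M \<eta>"
  by (rule intensity_half_open[OF radon_sets[OF \<eta>_radon] \<eta>_measurable \<eta>_shift finite_intensity[unfolded equal_intensity]])

definition unmatched :: "'w \<Rightarrow> real \<Rightarrow> ennreal" where
  "unmatched \<omega> x = flux \<omega> {..x} {\<infinity>}"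

lemma unmatched_shift: "\<omega> \<in> space M \<Longrightarrow> unmatched (\<theta> t \<omega>) x = unmatched \<omega> (x + t)"
proof -
  assume \<omega>: "\<omega> \<in> space M"
  have "{s. s - t \<in> {..x}} = {..x + t}" by auto
  then show ?thesis
    unfolding unmatched_def
    using flux_shift[OF \<omega>, of "{..x}" "{\<infinity>}" t] by (simp add: shift_infinity_ereal[unfolded singleton_iff])
qed

lemma unmatched_mono: "\<omega> \<in> space M \<Longrightarrow> x \<le> y \<Longrightarrow> unmatched \<omega> x \<le> unmatched \<omega> y"
  unfolding unmatched_def flux_def by (intro emeasure_mono flux_sets) auto

lemma unmatched_measurable: "(\<lambda>\<omega>. unmatched \<omega> x) \<in> borel_measurable M"
  unfolding unmatched_def by (rule flux_measurable) simp_all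

lemma flux_infinity_shift: "\<omega> \<in> space M \<Longrightarrow> flux (\<theta> t \<omega>) UNIV {\<infinity>} = flux \<omega> UNIV {\<infinity>}"
  using flux_shift[of \<omega> UNIV "{\<infinity>}" t] by (simp add: shift_infinity_ereal[unfolded singleton_iff])

text \<open>The event that the unmatched mass has a leftmost end and that this end lies in the cell between
  \<open>- 1\<close> and \<open>0\<close>.\<close>

definition first_unmatched :: "'w set" where
  "first_unmatched = {\<omega>\<in>space M. 0 < unmatched \<omega> 0 \<and> unmatched \<omega> (- 1) = 0}"

lemma first_unmatched_iff:
  "\<omega> \<in> space M \<Longrightarrow> \<theta> t \<omega> \<in> first_unmatched \<longleftrightarrow> 0 < unmatched \<omega> t \<and> unmatched \<omega> (t - 1) = 0"
  by (simp add: first_unmatched_def flow_space unmatched_shift)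

text \<open>The leftmost end of the unmatched mass lies in only one cell, so this event is wandering. If the
  underlying measure is finite, the constant \<open>1\<close> is integrable although its sum along each orbit is
  infinite. Otherwise the mass of \<open>\<xi>\<close> on unit cells is summed along the orbit: its total mass is
  finite on the event, hence zero, which contradicts the presence of unmatched mass.\<close>

lemma first_unmatched_null: "AE \<omega> in M. \<omega> \<notin> first_unmatched"
proof -
  have E: "first_unmatched \<in> sets M"
    unfolding first_unmatched_def using unmatched_measurable by measurable
  have less: False
    if "\<omega> \<in> space M" "\<theta> (real_of_int m) \<omega> \<in> first_unmatched" "\<theta> (real_of_int n) \<omega> \<in> first_unmatched" "m < n"
    for \<omega> m n
  proof -
    have "real_of_int m \<le> real_of_int n - 1" using \<open>m < n\<close> by linarith
    then have "unmatched \<omega> m \<le> unmatched \<omega> (real_of_int n - 1)"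
      by (rule unmatched_mono[OF that(1)])
    then show False using that first_unmatched_iff[OF that(1)] by auto
  qed
  then have wandering: "m = n"
    if "\<omega> \<in> space M" "\<theta> (real_of_int m) \<omega> \<in> first_unmatched" "\<theta> (real_of_int n) \<omega> \<in> first_unmatched"
    for \<omega> m n
    using that by (metis linorder_less_linear)
  from mass show ?thesis
  proof
    assume fin: "finite_measure M"
    have "(\<integral>\<^sup>+\<omega>. 1 \<partial>M) < \<infinity>"
      using finite_measure.emeasure_finite[OF fin, of "space M"] by (simp add: less_top)
    from wandering_orbit_sum_finite[OF E wandering _ this]
    have "AE \<omega> in M. \<omega> \<in> first_unmatched \<longrightarrow> (\<integral>\<^sup>+n. 1 \<partial>count_space (UNIV :: int set)) < (\<infinity> :: ennreal)"
      by simp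
    then show ?thesis
      by (simp add: infinite_UNIV_int)
  next
    assume dichotomy: "zero_or_infinite_mass M \<xi>"
    have "(\<integral>\<^sup>+\<omega>. emeasure (\<xi> \<omega>) {0<..1} \<partial>M) < \<infinity>"
      using \<xi>_intensity finite_intensity by simp
    from wandering_orbit_sum_finite[OF E wandering \<xi>_measurable this]
    have "AE \<omega> in M. \<omega> \<in> first_unmatched \<longrightarrow>
        (\<integral>\<^sup>+n. emeasure (\<xi> (\<theta> (real_of_int n) \<omega>)) {0<..1} \<partial>count_space UNIV) < \<infinity>"
      by simp
    with dichotomy[unfolded zero_or_infinite_mass_def] AE_space show ?thesis
    proof eventually_elim
      case (elim \<omega>)
      show ?case
      proof
        assume \<omega>: "\<omega> \<in> first_unmatched"
        have sets: "sets (\<xi> \<omega>) = sets borel" using elim(2) by (intro radon_sets \<xi>_radon)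
        have "emeasure (\<xi> \<omega>) UNIV = (\<integral>\<^sup>+n. emeasure (\<xi> \<omega>) {real_of_int n<..real_of_int n + 1} \<partial>count_space UNIV)"
        proof -
          have "(UNIV :: real set) = (\<Union>n. {real_of_int n<..real_of_int n + 1})"
            using unit_Ioc_iff by blast
          then have "emeasure (\<xi> \<omega>) UNIV = emeasure (\<xi> \<omega>) (\<Union>n. {real_of_int n<..real_of_int n + 1})"
            by (rule arg_cong)
          also have "\<dots> = (\<integral>\<^sup>+n. emeasure (\<xi> \<omega>) {real_of_int n<..real_of_int n + 1} \<partial>count_space UNIV)"
            by (rule emeasure_UN_countable)
              (auto simp: sets disjoint_family_on_def unit_Ioc_iff simp del: greaterThanAtMost_iff)
          finally show ?thesis .
        qed
        also have "\<dots> = (\<integral>\<^sup>+n. emeasure (\<xi> (\<theta> (real_of_int n) \<omega>)) {0<..1} \<partial>count_space UNIV)"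
        proof (rule nn_integral_cong)
          fix n :: int
          have "{x. x - real_of_int n \<in> {0<..1}} = {real_of_int n<..real_of_int n + 1}" by auto
          then show "emeasure (\<xi> \<omega>) {real_of_int n<..real_of_int n + 1} = emeasure (\<xi> (\<theta> (real_of_int n) \<omega>)) {0<..1}"
            using \<xi>_shift[OF elim(2), of "{0<..1}" "real_of_int n"] by simp
        qed
        also have "\<dots> < \<infinity>" using elim(3) \<omega> by simp
        finally have "emeasure (\<xi> \<omega>) UNIV = 0" using elim(1) by auto
        moreover have "unmatched \<omega> 0 \<le> emeasure (\<xi> \<omega>) UNIV"
          unfolding unmatched_def flux_def by (intro emeasure_mono) (auto simp: sets)
        ultimately show False using \<omega> by (auto simp: first_unmatched_def)
      qed
    qed
  qed
qed

text \<open>If some unmatched mass exists but none to the left of some integer, then some cell contains the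
  leftmost end of the unmatched mass.\<close>

lemma unmatched_everywhere_or_nowhere:
  "AE \<omega> in M. flux \<omega> UNIV {\<infinity>} = 0 \<or> (\<forall>n::int. 0 < unmatched \<omega> (real_of_int n))"
  using AE_flow_all_int[OF first_unmatched_null] AE_space
proof eventually_elim
  case (elim \<omega>)
  note \<omega> = elim(2)
  have step: "unmatched \<omega> (real_of_int (n + 1)) = 0" if "unmatched \<omega> (real_of_int n) = 0" for n
  proof -
    have "\<theta> (real_of_int (n + 1)) \<omega> \<notin> first_unmatched" using elim(1) by blast
    then show ?thesis using that by (simp add: first_unmatched_iff[OF \<omega>] not_gr_zero)
  qed
  show ?case
  proof (rule disjCI)
    assume "\<not> (\<forall>n::int. 0 < unmatched \<omega> (real_of_int n))"
    then obtain n0 :: int where n0: "unmatched \<omega> (real_of_int n0) = 0"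
      by (auto simp: not_gr_zero)
    have above: "unmatched \<omega> (real_of_int n) = 0" if "n0 \<le> n" for n
      using that by (induction n rule: int_ge_induct) (use n0 step in auto)
    have zero: "unmatched \<omega> (real m) = 0" for m :: nat
    proof -
      have "unmatched \<omega> (real m) \<le> unmatched \<omega> (real_of_int (max n0 (int m)))"
        by (intro unmatched_mono[OF \<omega>]) linarith
      also have "\<dots> = 0" by (rule above) simp
      finally show ?thesis by simp
    qed
    have "{s\<in>UNIV. \<tau> \<omega> s \<in> {\<infinity>}} = (\<Union>m. {s\<in>{..real m}. \<tau> \<omega> s \<in> {\<infinity>}})"
      using real_arch_simple by auto
    then have "flux \<omega> UNIV {\<infinity>} = emeasure (\<xi> \<omega>) (\<Union>m. {s\<in>{..real m}. \<tau> \<omega> s \<in> {\<infinity>}})"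
      unfolding flux_def by (rule arg_cong)
    also have "\<dots> = 0"
    proof (rule emeasure_UN_eq_0)
      show "emeasure (\<xi> \<omega>) {s\<in>{..real m}. \<tau> \<omega> s \<in> {\<infinity>}} = 0" for m
        using zero[of m] by (simp only: unmatched_def flux_def)
      show "range (\<lambda>m. {s\<in>{..real m}. \<tau> \<omega> s \<in> {\<infinity>}}) \<subseteq> sets (\<xi> \<omega>)"
      proof (rule image_subsetI)
        fix m show "{s\<in>{..real m}. \<tau> \<omega> s \<in> {\<infinity>}} \<in> sets (\<xi> \<omega>)"
          by (rule flux_sets[OF \<omega>]) simp_all
      qed
    qed
    finally show "flux \<omega> UNIV {\<infinity>} = 0" .
  qed
qed

lemma flux_eq_of_unmatched_everywhere:
  assumes \<omega>: "\<omega> \<in> space M" and unmatched: "\<And>n::int. 0 < unmatched \<omega> (real_of_int n)" and "a < b"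
  shows "flux \<omega> UNIV {ereal a<..ereal b} = emeasure (\<eta> \<omega>) {a<..b}"
proof -
  define n where "n = \<lceil>a\<rceil> - 2"
  have "real_of_int n < a" unfolding n_def by linarith
  have "{s\<in>{..real_of_int n}. \<tau> \<omega> s \<in> {\<infinity>}} \<noteq> {}"
  proof
    assume "{s\<in>{..real_of_int n}. \<tau> \<omega> s \<in> {\<infinity>}} = {}"
    then have "unmatched \<omega> (real_of_int n) = 0" by (simp only: unmatched_def flux_def emeasure_empty)
    with unmatched[of n] show False by simp
  qed
  then obtain c where "c \<le> real_of_int n" "\<tau> \<omega> c = \<infinity>" by auto
  then show ?thesis
    using radon_singular_pair.matched_mass_eq[OF regular[OF \<omega>] \<open>a < b\<close>, of c] \<open>real_of_int n < a\<close>
    by (simp add: flux_def \<tau>_def)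
qed

lemma flux_split_infinity:
  assumes \<omega>: "\<omega> \<in> space M" and A: "A \<in> sets borel"
  shows "emeasure (\<xi> \<omega>) A = flux \<omega> A (- {\<infinity>}) + flux \<omega> A {\<infinity>}"
proof -
  have "A = {s\<in>A. \<tau> \<omega> s \<in> - {\<infinity>}} \<union> {s\<in>A. \<tau> \<omega> s \<in> {\<infinity>}}" by auto
  then have "emeasure (\<xi> \<omega>) A = emeasure (\<xi> \<omega>) ({s\<in>A. \<tau> \<omega> s \<in> - {\<infinity>}} \<union> {s\<in>A. \<tau> \<omega> s \<in> {\<infinity>}})"
    by (rule arg_cong)
  also have "\<dots> = flux \<omega> A (- {\<infinity>}) + flux \<omega> A {\<infinity>}"
    unfolding flux_def
  proof (rule plus_emeasure[symmetric])
    show "{s\<in>A. \<tau> \<omega> s \<in> - {\<infinity>}} \<in> sets (\<xi> \<omega>)" "{s\<in>A. \<tau> \<omega> s \<in> {\<infinity>}} \<in> sets (\<xi> \<omega>)"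
      by (rule flux_sets[OF \<omega> A]; simp)+
  qed auto
  finally show ?thesis .
qed

text \<open>The image of \<open>\<xi>\<close> is at most \<open>\<eta>\<close> and, by mass transport, both have the same finite mean mass on
  \<open>{0<..1}\<close>.\<close>

lemma balance_of_all_matched:
  assumes matched: "AE \<omega> in M. flux \<omega> UNIV {\<infinity>} = 0"
  shows "AE \<omega> in M. \<forall>a b. a < b \<longrightarrow> flux \<omega> UNIV {ereal a<..ereal b} = emeasure (\<eta> \<omega>) {a<..b}"
proof -
  have "(\<integral>\<^sup>+\<omega>. flux \<omega> {0<..1} (- {\<infinity>}) \<partial>M) = (\<integral>\<^sup>+\<omega>. emeasure (\<xi> \<omega>) {0<..1} \<partial>M)"
  proof (rule nn_integral_cong_AE)
    from matched AE_space show "AE \<omega> in M. flux \<omega> {0<..1} (- {\<infinity>}) = emeasure (\<xi> \<omega>) {0<..1}"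
    proof eventually_elim
      case (elim \<omega>)
      have "flux \<omega> {0<..1} {\<infinity>} \<le> flux \<omega> UNIV {\<infinity>}"
        unfolding flux_def by (intro emeasure_mono flux_sets elim(2)) auto
      then show ?case using flux_split_infinity[OF elim(2), of "{0<..1}"] elim(1) by simp
    qed
  qed
  then have "(\<integral>\<^sup>+\<omega>. flux \<omega> UNIV {ereal 0<..ereal 1} \<partial>M) = (\<integral>\<^sup>+\<omega>. emeasure (\<eta> \<omega>) {0<..1} \<partial>M)"
    by (simp only: mass_transport \<xi>_intensity \<eta>_intensity equal_intensity)
  then have "AE \<omega> in M. flux \<omega> UNIV {ereal 0<..ereal 1} = emeasure (\<eta> \<omega>) {0<..1}"
    using finite_intensity equal_intensity
    by (intro AE_eq_of_nn_integral_eq flux_measurable \<eta>_measurable flux_UNIV_le) (simp_all only: \<eta>_intensity, simp_all)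
  from AE_flow_all_int[OF this] AE_space show ?thesis
  proof eventually_elim
    case (elim \<omega>)
    have unit: "flux \<omega> UNIV {ereal (real_of_int n)<..ereal (real_of_int n + 1)} = emeasure (\<eta> \<omega>) {real_of_int n<..real_of_int n + 1}"
      for n :: int
    proof -
      have "flux (\<theta> (real_of_int n) \<omega>) UNIV {ereal 0<..ereal 1} = flux \<omega> UNIV {ereal (real_of_int n)<..ereal (real_of_int n + 1)}"
        unfolding flux_shift[OF elim(2) sets.top[of borel, unfolded space_borel] greaterThanAtMost_borel] shift_Ioc_ereal
        by (simp add: add.commute)
      moreover have "{x. x - real_of_int n \<in> {0<..1}} = {real_of_int n<..real_of_int n + 1}" by auto
      then have "emeasure (\<eta> (\<theta> (real_of_int n) \<omega>)) {0<..1} = emeasure (\<eta> \<omega>) {real_of_int n<..real_of_int n + 1}"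
        using \<eta>_shift[OF elim(2), of "{0<..1}" "real_of_int n"] by simp
      ultimately show ?thesis using elim(1) by metis
    qed
    show ?case
      using radon_singular_pair.matched_mass_eq_of_units[OF regular[OF elim(2)]] unit
      by (simp add: flux_def \<tau>_def)
  qed
qed

text \<open>Mass transport in the opposite direction: the mean matched mass of \<open>\<xi>\<close> on \<open>{0<..1}\<close> is the
  intensity of \<open>\<eta>\<close>, hence all of that of \<open>\<xi>\<close>.\<close>

lemma all_matched_of_balance:
  assumes balance: "AE \<omega> in M. flux \<omega> UNIV {ereal 0<..ereal 1} = emeasure (\<eta> \<omega>) {0<..1}"
  shows "AE \<omega> in M. flux \<omega> UNIV {\<infinity>} = 0"
proof -
  have "(\<integral>\<^sup>+\<omega>. flux \<omega> {0<..1} (- {\<infinity>}) \<partial>M) = (\<integral>\<^sup>+\<omega>. emeasure (\<eta> \<omega>) {0<..1} \<partial>M)"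
    unfolding mass_transport[symmetric] by (rule nn_integral_cong_AE[OF balance])
  then have "(\<integral>\<^sup>+\<omega>. flux \<omega> {0<..1} (- {\<infinity>}) \<partial>M) = (\<integral>\<^sup>+\<omega>. emeasure (\<xi> \<omega>) {0<..1} \<partial>M)"
    by (simp only: \<xi>_intensity \<eta>_intensity equal_intensity)
  then have "AE \<omega> in M. flux \<omega> {0<..1} (- {\<infinity>}) = emeasure (\<xi> \<omega>) {0<..1}"
    using finite_intensity
    by (intro AE_eq_of_nn_integral_eq flux_measurable \<xi>_measurable flux_le) (simp_all only: \<xi>_intensity, simp_all)
  then have "AE \<omega> in M. flux \<omega> {0<..1} {\<infinity>} = 0"
    using AE_space
  proof eventually_elim
    case (elim \<omega>)
    have "emeasure (\<xi> \<omega>) {0<..1} < \<infinity>"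
      by (rule radon_finite[OF \<xi>_radon[OF elim(2)], of _ 0 1]) auto
    then show ?case
      using flux_split_infinity[OF elim(2), of "{0<..1}"] elim(1)
      by (metis (no_types, lifting) add.right_neutral ennreal_add_left_cancel greaterThanAtMost_borel less_irrefl)
  qed
  from AE_flow_all_int[OF this] AE_space show ?thesis
  proof eventually_elim
    case (elim \<omega>)
    have null: "flux \<omega> {real_of_int n<..real_of_int n + 1} {\<infinity>} = 0" for n
    proof -
      have "{s. s - real_of_int n \<in> {0<..1}} = {real_of_int n<..real_of_int n + 1}" by auto
      then show ?thesis
        using elim(1) flux_shift[OF elim(2), of "{0<..1}" "{\<infinity>}" "real_of_int n"] by (simp add: shift_infinity_ereal[unfolded singleton_iff])
    qed
    have "{s\<in>UNIV. \<tau> \<omega> s \<in> {\<infinity>}} = (\<Union>n. {s\<in>{real_of_int n<..real_of_int n + 1}. \<tau> \<omega> s \<in> {\<infinity>}})"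
      using unit_Ioc_iff by blast
    then have "flux \<omega> UNIV {\<infinity>} = emeasure (\<xi> \<omega>) (\<Union>n. {s\<in>{real_of_int n<..real_of_int n + 1}. \<tau> \<omega> s \<in> {\<infinity>}})"
      unfolding flux_def by (rule arg_cong)
    also have "\<dots> = (\<integral>\<^sup>+n. flux \<omega> {real_of_int n<..real_of_int n + 1} {\<infinity>} \<partial>count_space UNIV)"
      unfolding flux_def
    proof (rule emeasure_UN_countable)
      show "{s\<in>{real_of_int n<..real_of_int n + 1}. \<tau> \<omega> s \<in> {\<infinity>}} \<in> sets (\<xi> \<omega>)" for n
        by (rule flux_sets[OF elim(2)]) simp_all
      show "disjoint_family (\<lambda>n. {s\<in>{real_of_int n<..real_of_int n + 1}. \<tau> \<omega> s \<in> {\<infinity>}})"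
        by (auto simp: disjoint_family_on_def unit_Ioc_iff simp del: greaterThanAtMost_iff)
    qed simp
    also have "\<dots> = 0" by (simp add: null)
    finally show ?case .
  qed
qed

text \<open>The event that nothing is unmatched is invariant, hence trivial. If it is null, every bounded
  interval lies to the right of an unmatched point, so that the image of \<open>\<xi>\<close> is \<open>\<eta>\<close> there and mass
  transport makes the unmatched mass vanish.\<close>

lemma balance:
  "AE \<omega> in M. flux \<omega> UNIV {\<infinity>} = 0 \<and>
    (\<forall>a b. a < b \<longrightarrow> flux \<omega> UNIV {ereal a<..ereal b} = emeasure (\<eta> \<omega>) {a<..b})"
proof -
  define A where "A = {\<omega>\<in>space M. flux \<omega> UNIV {\<infinity>} = 0}"
  have "(\<lambda>\<omega>. flux \<omega> UNIV {\<infinity>}) \<in> borel_measurable M" by (rule flux_measurable) simp_all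
  then have "A \<in> sets M" unfolding A_def by measurable
  then have "(AE \<omega> in M. \<omega> \<notin> A) \<or> (AE \<omega> in M. \<omega> \<in> A)"
    by (rule zero_one_law) (simp add: A_def flow_space flux_infinity_shift)
  then have "AE \<omega> in M. flux \<omega> UNIV {\<infinity>} = 0"
  proof
    assume "AE \<omega> in M. \<omega> \<notin> A"
    with unmatched_everywhere_or_nowhere AE_space
    have "AE \<omega> in M. flux \<omega> UNIV {ereal 0<..ereal 1} = emeasure (\<eta> \<omega>) {0<..1}"
      by eventually_elim (auto simp: A_def intro!: flux_eq_of_unmatched_everywhere)
    then show ?thesis by (rule all_matched_of_balance)
  next
    assume "AE \<omega> in M. \<omega> \<in> A"
    then show ?thesis by eventually_elim (simp add: A_def)
  qed
  with balance_of_all_matched[OF this] show ?thesis by eventually_elim simp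
qed

lemma balances_\<tau>: "balances M \<xi> \<eta> \<tau>"
  unfolding balances_def
proof
  from balance AE_space show "AE \<omega> in M. AE s in \<xi> \<omega>. \<tau> \<omega> s \<noteq> \<infinity>"
  proof eventually_elim
    case (elim \<omega>)
    show ?case
    proof (rule AE_I)
      show "emeasure (\<xi> \<omega>) {s\<in>UNIV. \<tau> \<omega> s \<in> {\<infinity>}} = 0" using elim(1) by (simp only: flux_def)
      show "{s\<in>UNIV. \<tau> \<omega> s \<in> {\<infinity>}} \<in> sets (\<xi> \<omega>)" by (rule flux_sets[OF elim(2)]) simp_all
    qed auto
  qed
  from balance AE_space
  show "AE \<omega> in M. \<forall>C\<in>sets borel. (\<integral>\<^sup>+s. indicator (ereal ` C) (\<tau> \<omega> s) \<partial>\<xi> \<omega>) = emeasure (\<eta> \<omega>) C"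
  proof eventually_elim
    case (elim \<omega>)
    note \<omega> = elim(2)
    have sets: "sets (\<xi> \<omega>) = sets borel" "sets (\<eta> \<omega>) = sets borel"
      using radon_sets \<xi>_radon[OF \<omega>] \<eta>_radon[OF \<omega>] by auto
    have \<tau>[measurable]: "\<tau> \<omega> \<in> borel_measurable (\<xi> \<omega>)"
      using \<tau>_borel[OF \<omega>] by (simp add: measurable_cong_sets[OF sets(1) refl])
    \<comment> \<open>The image of \<open>\<xi> \<omega>\<close> under \<open>\<tau> \<omega>\<close>, made into a measure on the real line by discarding unmatched
      mass, is compared with \<open>\<eta> \<omega>\<close> on half-open intervals.\<close>
    define \<rho> where "\<rho> = distr (density (\<xi> \<omega>) (indicator {s. \<tau> \<omega> s \<noteq> \<infinity>})) borel (\<lambda>s. real_of_ereal (\<tau> \<omega> s))"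
    have finite_sets: "{s. \<tau> \<omega> s \<noteq> \<infinity>} \<in> sets (\<xi> \<omega>)"
      using flux_sets[OF \<omega>, of UNIV "- {\<infinity>}"] by simp
    have \<rho>: "emeasure \<rho> C = emeasure (\<xi> \<omega>) {s\<in>UNIV. \<tau> \<omega> s \<in> ereal ` C}" if C: "C \<in> sets borel" for C
    proof -
      have "emeasure \<rho> C = emeasure (density (\<xi> \<omega>) (indicator {s. \<tau> \<omega> s \<noteq> \<infinity>})) ((\<lambda>s. real_of_ereal (\<tau> \<omega> s)) -` C \<inter> space (\<xi> \<omega>))"
        unfolding \<rho>_def using C by (subst emeasure_distr) simp_all
      also have "\<dots> = emeasure (\<xi> \<omega>) ({s. \<tau> \<omega> s \<noteq> \<infinity>} \<inter> ((\<lambda>s. real_of_ereal (\<tau> \<omega> s)) -` C \<inter> space (\<xi> \<omega>)))"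
        using C finite_sets by (intro emeasure_restricted) simp_all
      also have "{s. \<tau> \<omega> s \<noteq> \<infinity>} \<inter> ((\<lambda>s. real_of_ereal (\<tau> \<omega> s)) -` C \<inter> space (\<xi> \<omega>)) = {s\<in>UNIV. \<tau> \<omega> s \<in> ereal ` C}"
      proof (rule set_eqI)
        fix s
        have "space (\<xi> \<omega>) = UNIV" using sets_eq_imp_space_eq[OF sets(1)] by simp
        then show "s \<in> {s. \<tau> \<omega> s \<noteq> \<infinity>} \<inter> ((\<lambda>s. real_of_ereal (\<tau> \<omega> s)) -` C \<inter> space (\<xi> \<omega>)) \<longleftrightarrow> s \<in> {s\<in>UNIV. \<tau> \<omega> s \<in> ereal ` C}"
          using \<tau>_not_minus_infinity[of \<omega> s] by (cases "\<tau> \<omega> s") auto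
      qed
      finally show ?thesis .
    qed
    have "\<rho> = \<eta> \<omega>"
    proof (rule measure_eqI_generator_eq[where \<Omega> = UNIV])
      fix X assume "X \<in> range (\<lambda>(a, b). {a<..b::real})"
      then obtain a b where X: "X = {a<..b}" by auto
      show "emeasure \<rho> X = emeasure (\<eta> \<omega>) X"
        using elim(1) by (cases "a < b") (simp_all add: X \<rho> flux_def ereal_image_Ioc)
    next
      show "(\<Union>i. {- real (i::nat)<..real i}) = UNIV" by (rule UN_Ioc_eq_UNIV)
      have "emeasure (\<eta> \<omega>) {- real i<..real i} < \<infinity>" for i
        by (rule radon_finite[OF \<eta>_radon[OF \<omega>], of _ "- real i" "real i"]) auto
      moreover have "emeasure \<rho> {- real i<..real i} = emeasure (\<eta> \<omega>) {- real i<..real i}" for i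
        using elim(1) by (cases "- real i < real i") (simp_all add: \<rho> flux_def ereal_image_Ioc)
      ultimately show "emeasure \<rho> {- real i<..real i} \<noteq> \<infinity>" for i
        by (simp add: less_top[symmetric])
    qed (auto simp: \<rho>_def sets borel_sigma_sets_Ioc Int_stable_def)
    moreover have "(\<integral>\<^sup>+s. indicator (ereal ` C) (\<tau> \<omega> s) \<partial>\<xi> \<omega>) = emeasure \<rho> C" if C: "C \<in> sets borel" for C
    proof -
      have "ereal ` C \<in> sets borel" using C by (rule ereal_image_borel)
      then have "{s\<in>UNIV. \<tau> \<omega> s \<in> ereal ` C} \<in> sets (\<xi> \<omega>)" by (intro flux_sets \<omega>) simp
      then have "(\<integral>\<^sup>+s. indicator {s\<in>UNIV. \<tau> \<omega> s \<in> ereal ` C} s \<partial>\<xi> \<omega>) = emeasure \<rho> C"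
        by (simp only: nn_integral_indicator \<rho>[OF C])
      then show ?thesis by (simp add: indicator_def)
    qed
    ultimately show ?case by simp
  qed
qed

end


section \<open>Invariance almost everywhere\<close>

lemma radon_singular_pair_translate:
  assumes "radon_singular_pair \<mu> \<nu>"
    and sets: "sets \<mu>' = sets borel" "sets \<nu>' = sets borel"
    and \<mu>': "\<And>C. C \<in> sets borel \<Longrightarrow> emeasure \<mu>' C = emeasure \<mu> {x. x - t \<in> C}"
    and \<nu>': "\<And>C. C \<in> sets borel \<Longrightarrow> emeasure \<nu>' C = emeasure \<nu> {x. x - t \<in> C}"
  shows "radon_singular_pair \<mu>' \<nu>'"
proof -
  interpret radon_singular_pair \<mu> \<nu> by fact
  have fin: "locally_finite \<kappa>'"
    if "radon \<kappa>" and \<kappa>': "\<And>C. C \<in> sets borel \<Longrightarrow> emeasure \<kappa>' C = emeasure \<kappa> {x. x - t \<in> C}" for \<kappa> \<kappa>'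
    unfolding locally_finite_def
  proof (intro allI impI)
    fix C :: "real set" assume C: "compact C"
    have "{x. x - t \<in> C} = (+) t ` C"
      by (auto intro!: image_eqI[of _ _ "_ - t"])
    then have "compact {x. x - t \<in> C}" using compact_translation[OF C, of t] by simp
    then have "emeasure \<kappa> {x. x - t \<in> C} < \<infinity>"
      using \<open>radon \<kappa>\<close> by (simp add: radon_def locally_finite_def)
    then show "emeasure \<kappa>' C < \<infinity>" using C by (simp add: \<kappa>' compact_imp_closed)
  qed
  obtain A where A: "A \<in> sets borel" "emeasure \<mu> A = 0" "emeasure \<nu> (- A) = 0"
    using singular unfolding mutually_singular_def by blast
  define A' where "A' = (\<lambda>x. x + t) -` A \<inter> space borel"
  have A': "A' \<in> sets borel"
    unfolding A'_def using A(1) by (intro measurable_sets[of _ borel borel]) simp_all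
  have "{x. x - t \<in> A'} = A" "{x. x - t \<in> - A'} = - A"
    by (auto simp: A'_def)
  then have "emeasure \<mu>' A' = 0" "emeasure \<nu>' (- A') = 0"
    using A A' by (simp_all add: \<mu>' \<nu>' borel_comp)
  moreover have "emeasure \<mu>' {u} = 0" for u
  proof -
    have "{x. x - t \<in> {u}} = {u + t}" by auto
    then show ?thesis using \<mu>'[of "{u}"] atomless by (simp add: diffuse_def)
  qed
  ultimately show ?thesis
    using fin[OF \<mu> \<mu>'] fin[OF \<nu> \<nu>'] sets A'
    unfolding radon_singular_pair_def radon_def diffuse_def mutually_singular_def by blast
qed

lemma radon_singular_pair_null: "radon_singular_pair (null_measure borel) (null_measure borel)"
  unfolding radon_singular_pair_def radon_def diffuse_def mutually_singular_def locally_finite_def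
  by auto

lemma invariant_random_measure_shift:
  assumes "invariant_random_measure M \<theta> \<xi>"
  shows "AE \<omega> in M. \<forall>C\<in>sets borel. \<forall>t. emeasure (\<xi> (\<theta> t \<omega>)) C = emeasure (\<xi> \<omega>) {x. x - t \<in> C}"
proof -
  have "AE \<omega> in M. \<forall>C\<in>sets borel. \<forall>t. emeasure (\<xi> (\<theta> t \<omega>)) ((\<lambda>x. x - t) ` C) = emeasure (\<xi> \<omega>) C"
    using assms by (simp add: invariant_random_measure_def)
  then show ?thesis
  proof eventually_elim
    case (elim \<omega>)
    show ?case
    proof (intro ballI allI)
      fix C t assume C: "C \<in> sets (borel :: real measure)"
      have "(\<lambda>x. x - t) -` C \<inter> space borel \<in> sets borel"
        using C by (intro measurable_sets[of _ borel borel]) simp_all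
      then have "{x. x - t \<in> C} \<in> sets borel" by (simp add: vimage_def)
      moreover have "(\<lambda>x. x - t) ` {x. x - t \<in> C} = C"
        by (auto intro!: image_eqI[of _ _ "_ + t"])
      ultimately show "emeasure (\<xi> (\<theta> t \<omega>)) C = emeasure (\<xi> \<omega>) {x. x - t \<in> C}"
        using elim by metis
    qed
  qed
qed

theorem theorem1p1:
  fixes M :: "'w measure" and \<theta> :: "real \<Rightarrow> 'w \<Rightarrow> 'w" and \<xi> \<eta> :: "'w \<Rightarrow> real measure"
  assumes "stationary_ergodic_flow M \<theta>"
    and "invariant_random_measure M \<theta> \<xi>"
    and "invariant_random_measure M \<theta> \<eta>"
    and "intensity M \<xi> < \<infinity>"
    and "intensity M \<eta> < \<infinity>"
    and "AE \<omega> in M. mutually_singular (\<xi> \<omega>) (\<eta> \<omega>)"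
    and "AE \<omega> in M. diffuse (\<xi> \<omega>)"
    and "intensity M \<xi> = intensity M \<eta>"
    and "finite_measure M \<or> zero_or_infinite_mass M \<xi>"
  shows "(\<exists>\<tau>. allocation M \<theta> \<tau> \<and>
            (\<forall>\<omega>\<in>space M. regular_at \<xi> \<eta> \<omega> \<longrightarrow> (\<forall>s. \<tau> \<omega> s = first_match \<xi> \<eta> \<omega> s))) \<and>
         balances M \<xi> \<eta> (first_match \<xi> \<eta>)"
proof -
  interpret stationary_ergodic_flow M \<theta> by fact
  have \<xi>: "random_measure M \<xi>" and \<eta>: "random_measure M \<eta>"
    using assms(2,3) by (simp_all add: invariant_random_measure_def)
  have sets: "sets (\<xi> \<omega>) = sets borel" "sets (\<eta> \<omega>) = sets borel" if "\<omega> \<in> space M" for \<omega>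
    using \<xi> \<eta> that by (simp_all add: random_measure_def)
  have meas: "(\<lambda>\<omega>. emeasure (\<xi> \<omega>) C) \<in> borel_measurable M" "(\<lambda>\<omega>. emeasure (\<eta> \<omega>) C) \<in> borel_measurable M"
    if "C \<in> sets borel" for C
    using \<xi> \<eta> that by (simp_all add: random_measure_def)
  have finite: "AE \<omega> in M. locally_finite (\<xi> \<omega>)" "AE \<omega> in M. locally_finite (\<eta> \<omega>)"
    using \<xi> \<eta> by (simp_all add: random_measure_def)
  \<comment> \<open>The properties collected in \<open>Q\<close> hold almost everywhere and are inherited along orbits. Covariance
    at \<open>\<omega>\<close> determines the measures on the whole orbit from those at \<open>\<omega>\<close>.\<close>
  define covariant where "covariant \<kappa> \<omega> \<longleftrightarrow>
    (\<forall>C\<in>sets borel. \<forall>t. emeasure (\<kappa> (\<theta> t \<omega>)) C = emeasure (\<kappa> \<omega>) {x. x - t \<in> C})"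
    for \<kappa> :: "'w \<Rightarrow> real measure" and \<omega>
  define Q where "Q \<omega> \<longleftrightarrow> covariant \<xi> \<omega> \<and> covariant \<eta> \<omega> \<and> radon_singular_pair (\<xi> \<omega>) (\<eta> \<omega>)" for \<omega>
  have Q_AE: "AE \<omega> in M. Q \<omega>"
    using invariant_random_measure_shift[OF assms(2)] invariant_random_measure_shift[OF assms(3)]
      finite assms(6,7) AE_space
    by eventually_elim
      (simp add: Q_def covariant_def radon_singular_pair_def radon_def sets)
  have covariant_shift: "covariant \<kappa> (\<theta> t \<omega>)" if \<omega>: "\<omega> \<in> space M" and cov: "covariant \<kappa> \<omega>" for \<kappa> \<omega> t
    unfolding covariant_def
  proof (intro ballI allI)
    fix C u assume C: "C \<in> sets (borel :: real measure)"
    have "(\<lambda>x. x - u) -` C \<inter> space borel \<in> sets borel"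
      using C by (intro measurable_sets[of _ borel borel]) simp_all
    then have D: "{x. x - u \<in> C} \<in> sets borel" by (simp add: vimage_def)
    have "emeasure (\<kappa> (\<theta> u (\<theta> t \<omega>))) C = emeasure (\<kappa> \<omega>) {x. x - (u + t) \<in> C}"
      using cov C by (simp add: flow_add[OF \<omega>] covariant_def)
    also have "{x. x - (u + t) \<in> C} = {x. x - t \<in> {x. x - u \<in> C}}"
      by (simp add: algebra_simps)
    also have "emeasure (\<kappa> \<omega>) \<dots> = emeasure (\<kappa> (\<theta> t \<omega>)) {x. x - u \<in> C}"
      using cov D unfolding covariant_def by metis
    finally show "emeasure (\<kappa> (\<theta> u (\<theta> t \<omega>))) C = emeasure (\<kappa> (\<theta> t \<omega>)) {x. x - u \<in> C}" .
  qed
  have Q_shift: "Q (\<theta> t \<omega>)" if \<omega>: "\<omega> \<in> space M" and Q: "Q \<omega>" for \<omega> t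
  proof -
    have "radon_singular_pair (\<xi> (\<theta> t \<omega>)) (\<eta> (\<theta> t \<omega>))"
    proof (rule radon_singular_pair_translate[OF _ sets[OF flow_space[OF \<omega>]]])
      show "radon_singular_pair (\<xi> \<omega>) (\<eta> \<omega>)" using Q by (simp only: Q_def)
      fix C :: "real set" assume C: "C \<in> sets borel"
      show "emeasure (\<xi> (\<theta> t \<omega>)) C = emeasure (\<xi> \<omega>) {x. x - t \<in> C}"
        "emeasure (\<eta> (\<theta> t \<omega>)) C = emeasure (\<eta> \<omega>) {x. x - t \<in> C}"
        using Q C unfolding Q_def covariant_def by blast+
    qed
    then show ?thesis
      using Q covariant_shift[OF \<omega>] by (simp add: Q_def)
  qed
  obtain G where G: "G \<in> sets M" "AE \<omega> in M. \<omega> \<in> G" "\<And>\<omega>. \<omega> \<in> G \<Longrightarrow> Q \<omega>"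
    and G_shift: "\<And>\<omega> t. \<omega> \<in> space M \<Longrightarrow> \<theta> t \<omega> \<in> G \<longleftrightarrow> \<omega> \<in> G"
    using invariant_conull_core[OF Q_AE Q_shift] by blast
  have G_space: "\<omega> \<in> space M" if "\<omega> \<in> G" for \<omega>
    using sets.sets_into_space[OF G(1)] that by blast
  define \<xi>' \<eta>' where "\<xi>' \<omega> = (if \<omega> \<in> G then \<xi> \<omega> else null_measure borel)"
    and "\<eta>' \<omega> = (if \<omega> \<in> G then \<eta> \<omega> else null_measure borel)" for \<omega>
  have intensity_cong: "intensity M \<xi>' = intensity M \<xi>" "intensity M \<eta>' = intensity M \<eta>"
    unfolding intensity_def
    by (rule nn_integral_cong_AE, use G(2) in eventually_elim, simp add: \<xi>'_def \<eta>'_def)+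
  interpret balanced_flow M \<theta> \<xi>' \<eta>'
  proof (intro balanced_flow.intro matched_flow.intro balanced_flow_axioms.intro matched_flow_axioms.intro)
    show "stationary_ergodic_flow M \<theta>" by fact
  next
    fix \<omega> assume "\<omega> \<in> space M"
    show "radon_singular_pair (\<xi>' \<omega>) (\<eta>' \<omega>)"
      using G(3)[of \<omega>] by (auto simp: \<xi>'_def \<eta>'_def Q_def radon_singular_pair_null)
  next
    fix C :: "real set" assume C: "C \<in> sets borel"
    note [measurable] = meas[OF C] G(1)
    have "emeasure (\<xi>' \<omega>) C = (if \<omega> \<in> G then emeasure (\<xi> \<omega>) C else 0)"
      "emeasure (\<eta>' \<omega>) C = (if \<omega> \<in> G then emeasure (\<eta> \<omega>) C else 0)" for \<omega>
      by (simp_all add: \<xi>'_def \<eta>'_def)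
    then show "(\<lambda>\<omega>. emeasure (\<xi>' \<omega>) C) \<in> borel_measurable M"
      "(\<lambda>\<omega>. emeasure (\<eta>' \<omega>) C) \<in> borel_measurable M"
      by simp_all
  next
    fix \<omega> t and C :: "real set" assume \<omega>: "\<omega> \<in> space M" and C: "C \<in> sets borel"
    show "emeasure (\<xi>' (\<theta> t \<omega>)) C = emeasure (\<xi>' \<omega>) {x. x - t \<in> C}"
      "emeasure (\<eta>' (\<theta> t \<omega>)) C = emeasure (\<eta>' \<omega>) {x. x - t \<in> C}"
      using G(3)[of \<omega>] C by (auto simp: \<xi>'_def \<eta>'_def G_shift[OF \<omega>] Q_def covariant_def)
  next
    show "intensity M \<xi>' < \<infinity>" "intensity M \<xi>' = intensity M \<eta>'"
      using assms(4,8) by (simp_all add: intensity_cong)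
    show "finite_measure M \<or> zero_or_infinite_mass M \<xi>'"
      using assms(9)
    proof (rule disj_forward)
      assume "zero_or_infinite_mass M \<xi>"
      then have "AE \<omega> in M. emeasure (\<xi> \<omega>) UNIV = 0 \<or> emeasure (\<xi> \<omega>) UNIV = \<infinity>"
        by (simp add: zero_or_infinite_mass_def)
      with G(2) show "zero_or_infinite_mass M \<xi>'"
        unfolding zero_or_infinite_mass_def by eventually_elim (simp add: \<xi>'_def)
    qed
  qed
  have G_eq: "\<xi>' \<omega> = \<xi> \<omega>" "\<eta>' \<omega> = \<eta> \<omega>" if "\<omega> \<in> G" for \<omega>
    using that by (simp_all add: \<xi>'_def \<eta>'_def)
  have \<tau>_eq: "\<tau> \<omega> = first_match \<xi> \<eta> \<omega>" if "\<omega> \<in> G" for \<omega>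
    using that by (simp add: fun_eq_iff \<tau>_def first_match_eq \<xi>'_def \<eta>'_def)
  have "balances M \<xi> \<eta> (first_match \<xi> \<eta>)"
    unfolding balances_def
  proof
    from balances_\<tau> have "AE \<omega> in M. AE s in \<xi>' \<omega>. \<tau> \<omega> s \<noteq> \<infinity>" by (simp add: balances_def)
    with G(2) show "AE \<omega> in M. AE s in \<xi> \<omega>. first_match \<xi> \<eta> \<omega> s \<noteq> \<infinity>"
    proof eventually_elim
      case (elim \<omega>)
      show ?case using elim(2) by (simp only: \<tau>_eq[OF elim(1)] G_eq[OF elim(1)])
    qed
    from balances_\<tau> have "AE \<omega> in M. \<forall>C\<in>sets borel.
        (\<integral>\<^sup>+s. indicator (ereal ` C) (\<tau> \<omega> s) \<partial>\<xi>' \<omega>) = emeasure (\<eta>' \<omega>) C" by (simp add: balances_def)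
    with G(2) show "AE \<omega> in M. \<forall>C\<in>sets borel.
        (\<integral>\<^sup>+s. indicator (ereal ` C) (first_match \<xi> \<eta> \<omega> s) \<partial>\<xi> \<omega>) = emeasure (\<eta> \<omega>) C"
    proof eventually_elim
      case (elim \<omega>)
      show ?case using elim(2) by (simp only: \<tau>_eq[OF elim(1)] G_eq[OF elim(1)])
    qed
  qed
  \<comment> \<open>The rational description of the matching time is measurable for all realisations and coincides
    with it at the regular ones, which include the invariant event \<open>G\<close>.\<close>
  moreover define \<sigma> where "\<sigma> \<omega> = rational_match_time (\<xi> \<omega>) (\<eta> \<omega>)" for \<omega>
  have \<sigma>_regular: "\<sigma> \<omega> s = first_match \<xi> \<eta> \<omega> s" if "\<omega> \<in> space M" "regular_at \<xi> \<eta> \<omega>" for \<omega> s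
    using that by (simp add: \<sigma>_def first_match_eq regular_at_def rational_match_time_eq radon_def sets)
  have "allocation M \<theta> \<sigma>"
    unfolding allocation_def
  proof (intro conjI ballI allI)
    show "(\<lambda>(\<omega>, s). \<sigma> \<omega> s) \<in> borel_measurable (M \<Otimes>\<^sub>M borel)"
      unfolding \<sigma>_def by (rule rational_match_time_measurable) (simp_all add: meas)
    show "\<sigma> \<omega> s \<noteq> -\<infinity>" for \<omega> s
      using rational_match_time_ge[of s "\<xi> \<omega>" "\<eta> \<omega>"] by (auto simp: \<sigma>_def)
    have "\<sigma> \<omega> = \<tau> \<omega>" if "\<omega> \<in> G" for \<omega>
    proof -
      have "regular_at \<xi> \<eta> \<omega>"
        using G(3)[OF that] by (simp add: Q_def radon_singular_pair_def radon_def regular_at_def)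
      then show ?thesis
        using \<sigma>_regular[OF G_space[OF that]] by (simp add: fun_eq_iff \<tau>_eq[OF that])
    qed
    note \<sigma>_eq = this
    from G(2) show "AE \<omega> in M. \<forall>s t. \<sigma> (\<theta> t \<omega>) (s - t) = \<sigma> \<omega> s - ereal t"
      by eventually_elim (simp add: \<sigma>_eq G_shift G_space \<tau>_shift)
  qed
  ultimately show ?thesis using \<sigma>_regular by blast
qed

end
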